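(* Let $(\bar X,\bar\sigma)$ be an infinite minimal one-sided shift and let $(X,\sigma)$ be the corresponding two-sided shift. For $k>1$, let $\bar M_k$ be the number of branch points of order $k$ in $\bar X$, and let $M_k$ be the number of right asymptotic equivalence classes of size $k$ (i.e. consisting of exactly $k$ orbits) in $X$. Suppose that $(\bar X,\bar\sigma)$ has sublinear complexity, so that both $\bar M_k$ and $M_k$ are finite. Then (1) $\mathrm{Aut}(\bar X,\bar\sigma)$ has at most $\bar M:=\min\{\bar M_k : k>1,\ \bar M_k>0\}$ elements, and (2) $\mathrm{Aut}(X,\sigma)/\langle\sigma\rangle$ has at most $M:=\min\{M_k : k>1,\ M_k>0\}$ elements.
   Context: $\mathcal A$ is a finite alphabet; $\mathcal A^{\mathbb N_0}$ and $\mathcal A^{\mathbb Z}$ carry the product topology and the shift map. A one-sided (two-sided) shift is a closed shift-invariant subset of $\mathcal A^{\mathbb N_0}$ (of $\mathcal A^{\mathbb Z}$) with the shift map. The two-sided shift $(X,\sigma)$ corresponding to $(\bar X,\bar\sigma)$ consists of all bi-infinite sequences all of whose finite subwords belong to the language $\mathcal L_{\bar X}$ (the set of finite words occurring in points of $\bar X$). The complexity function $p(n)$ is the number of words of length $n$ in the language; the shift has sublinear complexity if $p$ is bounded above by a linear function of $n$. An endomorphism of a shift is a continuous onto self-map commuting with the shift; an automorphism is a one-to-one endomorphism; $\mathrm{Aut}$ denotes the group of automorphisms. $\langle\sigma\rangle$ is the (normal) subgroup of $\mathrm{Aut}(X,\sigma)$ generated by $\sigma$. For $k>1$, $\bar x\in\bar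 X$ is a branch point of order $k$ if $|\bar\sigma^{-1}(\bar x)|=k$. For $x\in X$ let $\mathcal O_x=\{\sigma^n x:n\in\mathbb Z\}$. Two orbits $\mathcal O_x,\mathcal O_y$ are right asymptotic if there is $m\in\mathbb Z$ with $x_{m+n}=y_n$ for all sufficiently large $n$; this is an equivalence relation on the set of orbits of $X$. *)

theory Defs
  imports "HOL-Analysis.Function_Topology" "HOL-Algebra.Bij" "HOL-Algebra.Coset"
    "HOL-Algebra.Generated_Groups"
begin

text \<open>
  Points are functions from an index type, \<^typ>\<open>nat\<close> for one-sided and \<^typ>\<open>int\<close> for two-sided
  sequences, into a finite alphabet, which is discrete.
\<close>

definition seq_topology :: "('i \<Rightarrow> 'a) topology" where
  "seq_topology = product_topology (\<lambda>_. discrete_topology UNIV) UNIV"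

definition shift :: "('i::{plus,one} \<Rightarrow> 'a) \<Rightarrow> 'i \<Rightarrow> 'a" where
  "shift x = (\<lambda>i. x (i + 1))"

definition one_sided_shift :: "(nat \<Rightarrow> 'a) set \<Rightarrow> bool" where
  "one_sided_shift X \<longleftrightarrow> closedin seq_topology X \<and> shift ` X \<subseteq> X"

definition minimal_one_sided_shift :: "(nat \<Rightarrow> 'a) set \<Rightarrow> bool" where
  "minimal_one_sided_shift X \<longleftrightarrow>
     one_sided_shift X \<and> X \<noteq> {} \<and>
     (\<forall>Y. one_sided_shift Y \<and> Y \<subseteq> X \<longrightarrow> Y = {} \<or> Y = X)"

definition language :: "(nat \<Rightarrow> 'a) set \<Rightarrow> 'a list set" where
  "language X = {map (\<lambda>j. x (i + j)) [0..<n] | x i n. x \<in> X}"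

definition complexity :: "(nat \<Rightarrow> 'a) set \<Rightarrow> nat \<Rightarrow> nat" where
  "complexity X n = card {w \<in> language X. length w = n}"

definition sublinear_complexity :: "(nat \<Rightarrow> 'a) set \<Rightarrow> bool" where
  "sublinear_complexity X \<longleftrightarrow>
     (\<exists>a b :: real. \<forall>n. real (complexity X n) \<le> a * real n + b)"

definition two_sided :: "(nat \<Rightarrow> 'a) set \<Rightarrow> (int \<Rightarrow> 'a) set" where
  "two_sided X = {x. \<forall>i n. map (\<lambda>j. x (i + int j)) [0..<n] \<in> language X}"

definition endomorphism ::
    "('i::{plus,one} \<Rightarrow> 'a) set \<Rightarrow> (('i \<Rightarrow> 'a) \<Rightarrow> 'i \<Rightarrow> 'a) \<Rightarrow> bool" where
  "endomorphism X f \<longleftrightarrow>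
     continuous_map (subtopology seq_topology X) (subtopology seq_topology X) f \<and>
     f ` X = X \<and> (\<forall>x\<in>X. f (shift x) = shift (f x))"

text \<open>
  Automorphisms are represented by functions that are \<^term>\<open>undefined\<close> outside \<open>X\<close>, so that
  distinct elements of the carrier are distinct as maps on \<open>X\<close>.  The group operation is
  composition, inherited from \<^const>\<open>BijGroup\<close>.
\<close>

definition Aut_shift :: "('i::{plus,one} \<Rightarrow> 'a) set \<Rightarrow> (('i \<Rightarrow> 'a) \<Rightarrow> 'i \<Rightarrow> 'a) monoid" where
  "Aut_shift X =
     (BijGroup X)\<lparr>carrier := {f \<in> extensional X. endomorphism X f \<and> inj_on f X}\<rparr>"

definition shift_subgroup :: "(int \<Rightarrow> 'a) set \<Rightarrow> ((int \<Rightarrow> 'a) \<Rightarrow> int \<Rightarrow> 'a) set" where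
  "shift_subgroup X = generate (Aut_shift X) {restrict shift X}"

definition branch_points :: "(nat \<Rightarrow> 'a) set \<Rightarrow> nat \<Rightarrow> (nat \<Rightarrow> 'a) set" where
  "branch_points X k = {x \<in> X. card {y \<in> X. shift y = x} = k}"

definition orbit :: "(int \<Rightarrow> 'a) \<Rightarrow> (int \<Rightarrow> 'a) set" where
  "orbit x = {\<lambda>i. x (i + n) | n. True}"

definition right_asymptotic :: "(int \<Rightarrow> 'a) set \<Rightarrow> ((int \<Rightarrow> 'a) set \<times> (int \<Rightarrow> 'a) set) set" where
  "right_asymptotic X =
     {(orbit x, orbit y) | x y. x \<in> X \<and> y \<in> X \<and>
        (\<exists>m. \<forall>\<^sub>F n in at_top. x (m + n) = y n)}"

definition asymptotic_classes :: "(int \<Rightarrow> 'a) set \<Rightarrow> nat \<Rightarrow> (int \<Rightarrow> 'a) set set set" where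
  "asymptotic_classes X k = {C \<in> (orbit ` X) // right_asymptotic X. card C = k}"

text \<open>
  For natural numbers \<open>Inf\<close> of a nonempty set is its minimum, while \<open>Inf {} = 0\<close>; since a group
  has at least one element, being bounded by these numbers entails that the minimum is taken over
  a nonempty set.
\<close>

definition min_branch :: "(nat \<Rightarrow> 'a) set \<Rightarrow> nat" where
  "min_branch X = Inf {card (branch_points X k) | k. k > 1 \<and> card (branch_points X k) > 0}"

definition min_asymptotic :: "(int \<Rightarrow> 'a) set \<Rightarrow> nat" where
  "min_asymptotic X =
     Inf {card (asymptotic_classes X k) | k. k > 1 \<and> card (asymptotic_classes X k) > 0}"

end

theory Submission
  imports Defs "HOL-Analysis.T1_Spaces"
begin

section \<open>Automorphisms of minimal shifts of sublinear complexity\<close>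

text \<open>
  Every branch point contributes a word of length \<open>n\<close> with two left extensions for all large \<open>n\<close>, so
  linear growth of the complexity leaves room for finitely many branch points only, and there is at
  least one because an injective one-sided shift is finite.  The position where two right
  asymptotic points last differ yields a branch point; since there are no eventually periodic
  points, this bounds the number and the size of the nontrivial asymptotic classes.

  An automorphism permutes the branch points of order \<open>k\<close> and, by minimality, is determined by its
  value at one of them.  A two-sided automorphism permutes the asymptotic classes of size \<open>k\<close>.  If
  two automorphisms send the orbit class of \<open>x\<close> to the same class, then after composing one of them
  with a power of the shift their values at \<open>x\<close> agree far to the right.  As automorphisms are block codes
  and every word of the language recurs in every right ray of \<open>x\<close>, they are then equal.
\<close>

subsection \<open>Closed sets of sequences and local rules\<close>

text \<open>In a product of discrete spaces the cylinders over finitely many coordinates form a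
  base. The index type is arbitrary, so one-sided and two-sided sequences are covered
  together.\<close>

lemma openin_seq_topology:
  "openin seq_topology U \<longleftrightarrow> (\<forall>x\<in>U. \<exists>D. finite D \<and> (\<forall>y. (\<forall>i\<in>D. y i = x i) \<longrightarrow> y \<in> U))"
  (is "?L \<longleftrightarrow> ?R")
proof
  assume ?L
  show ?R
  proof
    fix x assume "x \<in> U"
    with \<open>?L\<close> obtain V where V: "finite {i. V i \<noteq> UNIV}" "x \<in> Pi\<^sub>E UNIV V" "Pi\<^sub>E UNIV V \<subseteq> U"
      unfolding seq_topology_def openin_product_topology_alt by auto
    have "y \<in> U" if "\<forall>i\<in>{i. V i \<noteq> UNIV}. y i = x i" for y
    proof -
      have "y i \<in> V i" for i
        using that V(2) by (cases "V i = UNIV") (auto simp: PiE_iff)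
      then show ?thesis using V(3) by (auto simp: PiE_iff)
    qed
    with V(1) show "\<exists>D. finite D \<and> (\<forall>y. (\<forall>i\<in>D. y i = x i) \<longrightarrow> y \<in> U)" by blast
  qed
next
  assume R: ?R
  show ?L
    unfolding seq_topology_def openin_product_topology_alt
  proof
    fix x assume "x \<in> U"
    with R obtain D where D: "finite D" "\<And>y. (\<forall>i\<in>D. y i = x i) \<Longrightarrow> y \<in> U" by blast
    let ?V = "\<lambda>i. if i \<in> D then {x i} else UNIV"
    have "finite {i. ?V i \<noteq> UNIV}"
      using D(1) by (rule rev_finite_subset) auto
    moreover have "Pi\<^sub>E UNIV ?V \<subseteq> U"
    proof
      fix y assume y: "y \<in> Pi\<^sub>E UNIV ?V"
      have "y i = x i" if "i \<in> D" for i
        using PiE_mem[OF y, of i] that by simp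
      then show "y \<in> U" using D(2) by blast
    qed
    ultimately show "\<exists>V. finite {i \<in> UNIV. V i \<noteq> topspace (discrete_topology UNIV)} \<and>
        (\<forall>i\<in>UNIV. openin (discrete_topology UNIV) (V i)) \<and> x \<in> Pi\<^sub>E UNIV V \<and> Pi\<^sub>E UNIV V \<subseteq> U"
      by (intro exI[of _ ?V]) auto
  qed
qed

lemma topspace_seq_topology [simp]: "topspace seq_topology = UNIV"
  by (simp add: seq_topology_def)

text \<open>The complementary form of openness, which turns closedness proofs into checks on finite
  windows.\<close>

lemma closedin_seq_topology:
  "closedin seq_topology X \<longleftrightarrow> (\<forall>x. (\<forall>D. finite D \<longrightarrow> (\<exists>y\<in>X. \<forall>i\<in>D. y i = x i)) \<longrightarrow> x \<in> X)"
proof -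
  have "closedin seq_topology X \<longleftrightarrow> openin seq_topology (- X)"
    by (simp add: closedin_def Compl_eq_Diff_UNIV)
  moreover have "(\<exists>D. finite D \<and> (\<forall>y. (\<forall>i\<in>D. y i = x i) \<longrightarrow> y \<in> - X)) \<longleftrightarrow>
      \<not> (\<forall>D. finite D \<longrightarrow> (\<exists>y\<in>X. \<forall>i\<in>D. y i = x i))" for x
  proof -
    have "(\<forall>y. (\<forall>i\<in>D. y i = x i) \<longrightarrow> y \<in> - X) \<longleftrightarrow> \<not> (\<exists>y\<in>X. \<forall>i\<in>D. y i = x i)" for D
      by blast
    then show ?thesis by simp
  qed
  ultimately have "closedin seq_topology X \<longleftrightarrow>
      (\<forall>x\<in>- X. \<not> (\<forall>D. finite D \<longrightarrow> (\<exists>y\<in>X. \<forall>i\<in>D. y i = x i)))"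
    by (simp only: openin_seq_topology)
  also have "\<dots> \<longleftrightarrow> (\<forall>x. (\<forall>D. finite D \<longrightarrow> (\<exists>y\<in>X. \<forall>i\<in>D. y i = x i)) \<longrightarrow> x \<in> X)"
    unfolding Ball_def Compl_iff by (rule iff_allI) argo
  finally show ?thesis .
qed

lemma closedin_seq_topologyD:
  assumes "closedin seq_topology X" "\<And>D. finite D \<Longrightarrow> \<exists>y\<in>X. \<forall>i\<in>D. y i = x i"
  shows "x \<in> X"
proof -
  have "(\<forall>D. finite D \<longrightarrow> (\<exists>y\<in>X. \<forall>i\<in>D. y i = x i)) \<longrightarrow> x \<in> X"
    using assms(1) unfolding closedin_seq_topology by (rule spec)
  then show ?thesis using assms(2) by simp
qed

lemma Hausdorff_space_seq_topology: "Hausdorff_space seq_topology"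
  by (simp add: seq_topology_def Hausdorff_space_product_topology)

lemma compact_space_seq_topology: "compact_space (seq_topology :: ('i \<Rightarrow> 'a::finite) topology)"
  by (simp add: seq_topology_def compact_space_product_topology compact_space_discrete_topology)

lemma compactin_closed_seqs:
  "closedin seq_topology (X :: ('i \<Rightarrow> 'a::finite) set) \<Longrightarrow> compactin seq_topology X"
  using closedin_compact_space compact_space_seq_topology by blast

lemma continuous_map_shift: "continuous_map seq_topology seq_topology shift"
  unfolding seq_topology_def shift_def continuous_map_componentwise_UNIV
  by (intro allI continuous_map_product_projection) simp

text \<open>The compactness half of the Curtis-Hedlund-Lyndon theorem: near each point a finite
  window fixes coordinate \<open>k\<close> of the image, finitely many such cylinders cover
  \<open>X\<close>, and the union of their windows serves all points.\<close>

lemma continuous_map_local_rule: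
  fixes X :: "('i \<Rightarrow> 'a::finite) set" and f :: "('i \<Rightarrow> 'a) \<Rightarrow> 'i \<Rightarrow> 'a"
  assumes cl: "closedin seq_topology X"
    and cont: "continuous_map (subtopology seq_topology X) (subtopology seq_topology X) f"
  shows "\<exists>D. finite D \<and> (\<forall>x\<in>X. \<forall>y\<in>X. (\<forall>i\<in>D. x i = y i) \<longrightarrow> f x k = f y k)"
proof -
  have c: "continuous_map (subtopology seq_topology X) (discrete_topology UNIV) (\<lambda>x. f x k)"
  proof -
    have "continuous_map (subtopology seq_topology X) seq_topology f"
      using cont by (simp add: continuous_map_in_subtopology)
    then show ?thesis
      unfolding seq_topology_def continuous_map_componentwise_UNIV by blast
  qed
  have "\<exists>D. finite D \<and> (\<forall>y\<in>X. (\<forall>i\<in>D. y i = x i) \<longrightarrow> f y k = f x k)" if "x \<in> X" for x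
  proof -
    have "openin (subtopology seq_topology X) {y \<in> X. f y k \<in> {f x k}}"
      using openin_continuous_map_preimage[OF c, of "{f x k}"] by simp
    then obtain U where U: "openin seq_topology U" "{y \<in> X. f y k = f x k} = U \<inter> X"
      unfolding openin_subtopology by auto
    with that have "x \<in> U" by auto
    with U(1) obtain D where "finite D" "\<And>y. (\<forall>i\<in>D. y i = x i) \<Longrightarrow> y \<in> U"
      unfolding openin_seq_topology by blast
    with U(2) show ?thesis by (intro exI[of _ D]) auto
  qed
  then have "\<forall>x\<in>X. \<exists>D. finite D \<and> (\<forall>y\<in>X. (\<forall>i\<in>D. y i = x i) \<longrightarrow> f y k = f x k)"
    by blast
  from bchoice[OF this] obtain D where D: "\<And>x. x \<in> X \<Longrightarrow> finite (D x)"
      "\<And>x y. x \<in> X \<Longrightarrow> y \<in> X \<Longrightarrow> \<forall>i\<in>D x. y i = x i \<Longrightarrow> f y k = f x k"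
    by blast
  define C where "C x = {y. \<forall>i\<in>D x. y i = x i}" for x
  have "openin seq_topology (C x)" if "x \<in> X" for x
    unfolding openin_seq_topology C_def using D(1)[OF that] by (intro ballI exI[of _ "D x"]) auto
  then have "\<exists>\<F>. finite \<F> \<and> \<F> \<subseteq> C ` X \<and> X \<subseteq> \<Union> \<F>"
    by (intro compactinD[OF compactin_closed_seqs[OF cl]]) (auto simp: C_def)
  then obtain \<F> where \<F>: "finite \<F>" "\<F> \<subseteq> C ` X" "X \<subseteq> \<Union> \<F>" by blast
  from finite_subset_image[OF \<F>(1,2)] \<F>(3)
  obtain F where F: "finite F" "F \<subseteq> X" "X \<subseteq> \<Union> (C ` F)" by blast
  show ?thesis
  proof (intro exI[of _ "\<Union> (D ` F)"] conjI ballI impI)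
    show "finite (\<Union> (D ` F))" using F D(1) by blast
    fix x y assume xy: "x \<in> X" "y \<in> X" "\<forall>i\<in>\<Union> (D ` F). x i = y i"
    from F xy obtain z where z: "z \<in> F" "x \<in> C z" by blast
    then have "\<forall>i\<in>D z. x i = z i" "\<forall>i\<in>D z. y i = z i"
      using xy(3) by (auto simp: C_def)
    then have "f x k = f z k" "f y k = f z k"
      using D(2)[of z] z(1) F(2) xy(1,2) by blast+
    then show "f x k = f y k" by simp
  qed
qed

subsection \<open>The automorphism group\<close>

text \<open>A continuous bijection of a compact space onto a Hausdorff space is a homeomorphism, and
  injectivity carries the commutation with the shift over to the inverse.\<close>

lemma endomorphism_inverse:
  fixes X :: "('i::{plus,one} \<Rightarrow> 'a::finite) set"
  assumes cl: "closedin seq_topology X" and sh: "shift ` X \<subseteq> X"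
    and f: "endomorphism X f" and inj: "inj_on f X"
  shows "endomorphism X (inv_into X f)"
proof -
  let ?T = "subtopology seq_topology X"
  have onto: "f ` X = X" using f by (simp add: endomorphism_def)
  have "homeomorphic_map ?T ?T f"
    using f inj compactin_closed_seqs[OF cl]
    by (intro continuous_imp_homeomorphic_map)
      (auto simp: endomorphism_def compact_space_subtopology Hausdorff_space_subtopology
        Hausdorff_space_seq_topology)
  then obtain g where g: "homeomorphic_maps ?T ?T f g"
    using homeomorphic_map_maps by blast
  then have gc: "continuous_map ?T ?T g" and gf: "\<And>x. x \<in> X \<Longrightarrow> g (f x) = x"
    by (auto simp: homeomorphic_maps_def)
  have eq: "inv_into X f y = g y" if "y \<in> X" for y
    using that onto gf inj by (metis imageE inv_into_f_f)
  have "continuous_map ?T ?T (inv_into X f)"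
    by (rule continuous_map_eq[OF gc]) (simp add: eq)
  moreover have "inv_into X f ` X = X"
    by (metis onto inj inv_into_image_cancel order_refl)
  moreover have "inv_into X f (shift x) = shift (inv_into X f x)" if "x \<in> X" for x
  proof -
    have i: "inv_into X f x \<in> X" "f (inv_into X f x) = x"
      using that onto by (metis inv_into_into, metis f_inv_into_f)
    have "f (shift (inv_into X f x)) = shift x"
      using f i by (simp add: endomorphism_def)
    then show ?thesis
      using i(1) sh inj by (metis image_subset_iff inv_into_f_f)
  qed
  ultimately show ?thesis by (simp add: endomorphism_def)
qed

text \<open>Group elements are maps restricted to \<open>X\<close>; this passes from a map to its
  restriction. Invariance of \<open>X\<close> keeps \<open>shift x\<close> inside the domain of
  agreement.\<close>

lemma endomorphism_cong:
  assumes "endomorphism X f" "shift ` X \<subseteq> X" "\<And>x. x \<in> X \<Longrightarrow> g x = f x"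
  shows "endomorphism X g"
proof -
  have "continuous_map (subtopology seq_topology X) (subtopology seq_topology X) g"
    using assms(1,3) by (auto simp: endomorphism_def intro: continuous_map_eq)
  then show ?thesis using assms unfolding endomorphism_def by (auto simp: image_subset_iff)
qed

lemma endomorphism_compose:
  assumes "endomorphism X f" "endomorphism X g"
  shows "endomorphism X (f \<circ> g)"
proof -
  have "(f \<circ> g) ` X = X"
    using assms by (simp add: endomorphism_def image_comp[symmetric] del: o_apply)
  moreover have "g x \<in> X" if "x \<in> X" for x
    using assms(2) that by (auto simp: endomorphism_def)
  ultimately show ?thesis
    using assms unfolding endomorphism_def
    by (intro conjI ballI continuous_map_compose[of _ "subtopology seq_topology X"]) simp_all
qed

lemma endomorphism_id: "endomorphism X (\<lambda>x. x)"
  by (simp add: endomorphism_def)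

lemma endomorphism_shift:
  assumes "shift ` X = X"
  shows "endomorphism X shift"
  using assms continuous_map_from_subtopology[OF continuous_map_shift]
  by (simp add: endomorphism_def continuous_map_in_subtopology flip: image_subset_iff_funcset)

lemma carrier_Aut_shift:
  "carrier (Aut_shift X) = {f \<in> extensional X. endomorphism X f \<and> inj_on f X}"
  by (simp add: Aut_shift_def)

lemma one_Aut_shift: "\<one>\<^bsub>Aut_shift X\<^esub> = (\<lambda>x\<in>X. x)"
  by (simp add: Aut_shift_def BijGroup_def)

lemma carrier_Aut_shift_Bij: "carrier (Aut_shift X) \<subseteq> Bij X"
  by (auto simp: carrier_Aut_shift Bij_def bij_betw_def endomorphism_def)

lemma mult_Aut_shift:
  assumes "f \<in> carrier (Aut_shift X)" "g \<in> carrier (Aut_shift X)"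
  shows "f \<otimes>\<^bsub>Aut_shift X\<^esub> g = compose X f g"
  using assms carrier_Aut_shift_Bij[of X] by (auto simp: Aut_shift_def BijGroup_def)

lemma group_Aut_shift:
  fixes X :: "('i::{plus,one} \<Rightarrow> 'a::finite) set"
  assumes cl: "closedin seq_topology X" and sh: "shift ` X \<subseteq> X"
  shows "group (Aut_shift X)"
proof -
  have "subgroup (carrier (Aut_shift X)) (BijGroup X)"
  proof (rule group.subgroupI[OF group_BijGroup])
    show "carrier (Aut_shift X) \<subseteq> carrier (BijGroup X)"
      using carrier_Aut_shift_Bij by (simp add: BijGroup_def)
    have "endomorphism X (\<lambda>x\<in>X. x)"
      using endomorphism_cong[OF endomorphism_id sh] by simp
    then show "carrier (Aut_shift X) \<noteq> {}"
      by (auto simp: carrier_Aut_shift inj_on_def)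
  next
    fix f assume f: "f \<in> carrier (Aut_shift X)"
    then have fB: "f \<in> Bij X" using carrier_Aut_shift_Bij by blast
    have "endomorphism X (inv_into X f)"
      using f by (intro endomorphism_inverse[OF cl sh]) (auto simp: carrier_Aut_shift)
    then have "endomorphism X (restrict (inv_into X f) X)"
      by (rule endomorphism_cong[OF _ sh]) simp
    then show "inv\<^bsub>BijGroup X\<^esub> f \<in> carrier (Aut_shift X)"
      using restrict_inv_into_Bij[OF fB]
      by (simp add: inv_BijGroup[OF fB] carrier_Aut_shift Bij_def bij_betw_def)
  next
    fix f g assume fg: "f \<in> carrier (Aut_shift X)" "g \<in> carrier (Aut_shift X)"
    then have B: "f \<in> Bij X" "g \<in> Bij X" using carrier_Aut_shift_Bij by blast+
    have "endomorphism X (f \<circ> g)"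
      using fg by (simp add: carrier_Aut_shift endomorphism_compose)
    then have "endomorphism X (compose X f g)"
      by (rule endomorphism_cong[OF _ sh]) (simp add: compose_def)
    then show "f \<otimes>\<^bsub>BijGroup X\<^esub> g \<in> carrier (Aut_shift X)"
      using compose_Bij[OF B] B
      by (simp add: BijGroup_def carrier_Aut_shift Bij_def bij_betw_def)
  qed
  then show ?thesis
    using group.subgroup_imp_group[OF group_BijGroup] by (simp add: Aut_shift_def)
qed

text \<open>On \<open>S\<close> the value \<open>h a\<close> depends only on \<open>F a\<close>, so
  \<open>h\<close> factors through the image of \<open>F\<close>. The one-sided bound uses it with
  \<open>h\<close> the identity, the two-sided bound with \<open>h\<close> the coset map.\<close>

lemma card_image_le_of_factor:
  assumes fin: "finite T" and sub: "F ` S \<subseteq> T"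
    and factor: "\<And>a b. a \<in> S \<Longrightarrow> b \<in> S \<Longrightarrow> F a = F b \<Longrightarrow> h a = h b"
  shows "finite (h ` S) \<and> card (h ` S) \<le> card T"
proof -
  have "h ` S = (\<lambda>t. h (inv_into S F t)) ` (F ` S)"
  proof -
    have "h (inv_into S F (F a)) = h a" if "a \<in> S" for a
      using that by (intro factor) (simp_all add: inv_into_into f_inv_into_f)
    then show ?thesis by (auto simp: image_image)
  qed
  moreover have "finite (F ` S)" using sub fin by (rule finite_subset)
  moreover have "card (F ` S) \<le> card T" using fin sub by (rule card_mono)
  ultimately show ?thesis by (metis card_image_le finite_imageI order_trans)
qed

subsection \<open>Minimality, aperiodicity and branch points\<close>

text \<open>The branch points of all orders at once. Two explicit preimages avoid
  \<open>card\<close>, which is 0 on infinite sets.\<close>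

definition branching :: "(nat \<Rightarrow> 'a) set \<Rightarrow> (nat \<Rightarrow> 'a) set" where
  "branching X = {x \<in> X. \<exists>y\<in>X. \<exists>z\<in>X. y \<noteq> z \<and> shift y = x \<and> shift z = x}"

lemma shift_eq_imp_eq:
  fixes y z :: "nat \<Rightarrow> 'a"
  assumes "shift y = shift z" "y 0 = z 0"
  shows "y = z"
proof
  fix i show "y i = z i"
    using assms(2) fun_cong[OF assms(1), of "i - 1"] by (cases i) (simp_all add: shift_def)
qed

lemma branch_points_subset_branching:
  assumes "k > 1"
  shows "branch_points X k \<subseteq> branching X"
proof
  fix x assume x: "x \<in> branch_points X k"
  then have c: "card {y \<in> X. shift y = x} > 1"
    using assms by (simp add: branch_points_def)
  \<comment> \<open>\<open>card\<close> vanishes on infinite sets, so a value above 1 implies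
    finiteness.\<close>
  then have "finite {y \<in> X. shift y = x}" by (intro card_ge_0_finite) simp
  with c obtain y z where "y \<in> {y \<in> X. shift y = x}" "z \<in> {y \<in> X. shift y = x}" "y \<noteq> z"
    using card_le_Suc0_iff_eq[of "{y \<in> X. shift y = x}"] by force
  with x show "x \<in> branching X"
    by (auto simp: branching_def branch_points_def)
qed

text \<open>Preimages of one point differ in their first letter, so a finite alphabet allows only
  finitely many and the order is a true cardinality.\<close>

lemma branching_imp_branch_point:
  fixes X :: "(nat \<Rightarrow> 'a::finite) set"
  assumes "x \<in> branching X"
  shows "\<exists>k>1. x \<in> branch_points X k"
proof -
  let ?P = "{y \<in> X. shift y = x}"
  have "inj_on (\<lambda>y. y 0) ?P"
    by (auto simp: inj_on_def intro: shift_eq_imp_eq)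
  then have fin: "finite ?P"
    by (rule finite_imageD[rotated]) simp
  obtain y z where yz: "y \<in> ?P" "z \<in> ?P" "y \<noteq> z"
    using assms by (auto simp: branching_def)
  then have "\<not> card ?P \<le> Suc 0"
    using card_le_Suc0_iff_eq[OF fin] by blast
  moreover have "x \<in> X" using assms by (simp add: branching_def)
  ultimately show ?thesis
    by (intro exI[of _ "card ?P"]) (auto simp: branch_points_def)
qed

lemma finite_seqs_separated:
  fixes G :: "(nat \<Rightarrow> 'a) set"
  assumes "finite G"
  obtains N where "\<And>x y. x \<in> G \<Longrightarrow> y \<in> G \<Longrightarrow> \<forall>i<N. x i = y i \<Longrightarrow> x = y"
proof -
  \<comment> \<open>For \<open>x = y\<close> the choice is arbitrary, which does no harm:
    \<open>N\<close> is merely chosen above it as well.\<close>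
  define d :: "(nat \<Rightarrow> 'a) \<Rightarrow> (nat \<Rightarrow> 'a) \<Rightarrow> nat" where "d x y = (SOME i. x i \<noteq> y i)" for x y
  have d: "x (d x y) \<noteq> y (d x y)" if "x \<noteq> y" for x y
  proof -
    from that have "\<exists>i. x i \<noteq> y i" by auto
    then show ?thesis unfolding d_def by (rule someI_ex)
  qed
  have "finite ((\<lambda>(x, y). d x y) ` (G \<times> G))" using assms by simp
  then obtain N where "\<And>x y. x \<in> G \<Longrightarrow> y \<in> G \<Longrightarrow> d x y < N"
    by (auto simp: finite_nat_set_iff_bounded)
  then show ?thesis using d by (intro that[of N]) blast
qed

locale infinite_minimal_shift =
  fixes X :: "(nat \<Rightarrow> 'a::finite) set"
  assumes minimal: "minimal_one_sided_shift X"
    and infinite: "infinite X"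
begin

lemma closed: "closedin seq_topology X"
  using minimal by (simp add: minimal_one_sided_shift_def one_sided_shift_def)

lemma shift_subset: "shift ` X \<subseteq> X"
  using minimal by (simp add: minimal_one_sided_shift_def one_sided_shift_def)

lemma minimalD:
  "\<lbrakk>closedin seq_topology Y; shift ` Y \<subseteq> Y; Y \<subseteq> X; Y \<noteq> {}\<rbrakk> \<Longrightarrow> Y = X"
  using minimal by (auto simp: minimal_one_sided_shift_def one_sided_shift_def)

lemma tail_in: "x \<in> X \<Longrightarrow> (\<lambda>i. x (k + i)) \<in> X"
proof (induction k)
  case (Suc k)
  have "(\<lambda>i. x (Suc k + i)) = shift (\<lambda>i. x (k + i))" by (simp add: shift_def)
  with Suc show ?case using shift_subset by auto
qed simp

text \<open>The image is compact, hence closed, and it is invariant and nonempty, so minimality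
  applies.\<close>

lemma shift_image: "shift ` X = X"
proof (rule minimalD)
  show "closedin seq_topology (shift ` X)"
    using image_compactin[OF compactin_closed_seqs[OF closed] continuous_map_shift]
    by (rule compactin_imp_closedin[OF Hausdorff_space_seq_topology])
  show "shift ` X \<noteq> {}" using infinite by auto
qed (use shift_subset in auto)

text \<open>The points of \<open>X\<close> that avoid the word formed by the first \<open>n\<close>
  letters of \<open>u\<close> form a closed invariant set. It omits \<open>u\<close>, so by
  minimality it is empty.\<close>

lemma recurrence:
  assumes u: "u \<in> X" and v: "v \<in> X"
  shows "\<exists>j. \<forall>i<n. v (j + i) = u i"
proof (rule ccontr)
  assume no: "\<nexists>j. \<forall>i<n. v (j + i) = u i"
  define Y where "Y = {y \<in> X. \<forall>j. \<exists>i<n. y (j + i) \<noteq> u i}"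
  have "closedin seq_topology Y"
    unfolding closedin_seq_topology
  proof (intro allI impI)
    fix x assume x: "\<forall>D. finite D \<longrightarrow> (\<exists>y\<in>Y. \<forall>i\<in>D. y i = x i)"
    then have "\<exists>y\<in>X. \<forall>i\<in>D. y i = x i" if "finite D" for D
      using that unfolding Y_def by blast
    then have "x \<in> X"
      by (rule closedin_seq_topologyD[OF closed])
    moreover have "\<exists>i<n. x (j + i) \<noteq> u i" for j
    proof -
      obtain y where y: "y \<in> Y" "\<And>i. i \<in> {j..<j + n} \<Longrightarrow> y i = x i"
        using x by (metis finite_atLeastLessThan)
      from y(1) obtain i where "i < n" "y (j + i) \<noteq> u i" unfolding Y_def by blast
      with y(2)[of "j + i"] show ?thesis by auto
    qed
    ultimately show "x \<in> Y" by (simp add: Y_def)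
  qed
  moreover have "shift ` Y \<subseteq> Y"
  proof clarify
    fix y assume y: "y \<in> Y"
    have "\<exists>i<n. shift y (j + i) \<noteq> u i" for j
    proof -
      from y obtain i where "i < n" "y (Suc j + i) \<noteq> u i" unfolding Y_def by blast
      then show ?thesis by (auto simp: shift_def)
    qed
    then show "shift y \<in> Y" using y shift_subset by (auto simp: Y_def)
  qed
  moreover have "v \<in> Y" using no v by (auto simp: Y_def)
  ultimately have "Y = X" by (intro minimalD) (auto simp: Y_def)
  with u have "\<exists>i<n. u (0 + i) \<noteq> u i" unfolding Y_def by blast
  then show False by simp
qed

text \<open>An eventually periodic point has only finitely many late tails; they form a closed
  invariant set, which by minimality would be all of the infinite \<open>X\<close>.\<close>

lemma aperiodic:
  assumes x: "x \<in> X" and p: "p > 0"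
  shows "\<exists>n\<ge>N. x (n + p) \<noteq> x n"
proof (rule ccontr)
  assume "\<not> (\<exists>n\<ge>N. x (n + p) \<noteq> x n)"
  then have per: "x (n + p) = x n" if "n \<ge> N" for n using that by blast
  define T where "T k = (\<lambda>i. x (N + k + i))" for k
  have Tp: "T p = T 0"
  proof
    fix i show "T p i = T 0 i" using per[of "N + i"] by (simp add: T_def add_ac)
  qed
  have "T ` {..<p} = X"
  proof (rule minimalD)
    show "closedin seq_topology (T ` {..<p})"
      by (simp add: closedin_Hausdorff_finite Hausdorff_space_seq_topology)
    show "shift ` T ` {..<p} \<subseteq> T ` {..<p}"
    proof clarify
      fix k assume k: "k < p"
      have "shift (T k) = T (Suc k)" by (simp add: shift_def T_def)
      then show "shift (T k) \<in> T ` {..<p}"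
        using k Tp p by (cases "Suc k = p") auto
    qed
    show "T ` {..<p} \<subseteq> X" using tail_in[OF x] by (auto simp: T_def)
    show "T ` {..<p} \<noteq> {}" using p by auto
  qed
  then show False using infinite by (metis finite_imageI finite_lessThan)
qed

text \<open>Otherwise the shift is a homeomorphism and its inverse has a finite window:
  \<open>m\<close> consecutive letters determine the letter before them, hence everything to their
  left. Any finite subset of \<open>X\<close> then injects into the words of length
  \<open>m\<close>, read at one far position.\<close>

lemma branching_nonempty: "branching X \<noteq> {}"
proof
  assume "branching X = {}"
  then have inj: "inj_on shift X"
    using shift_subset by (intro inj_onI ccontr[of "_ = _"]) (auto simp: branching_def)
  have "endomorphism X (inv_into X shift)"
    using closed shift_subset endomorphism_shift[OF shift_image] inj by (rule endomorphism_inverse)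
  then obtain D where D: "finite D"
    "\<And>x y. x \<in> X \<Longrightarrow> y \<in> X \<Longrightarrow> \<forall>i\<in>D. x i = y i \<Longrightarrow> inv_into X shift x 0 = inv_into X shift y 0"
    using continuous_map_local_rule[OF closed, of "inv_into X shift" 0]
    unfolding endomorphism_def by blast
  from D(1) obtain m where m: "\<And>i. i \<in> D \<Longrightarrow> i < m"
    by (auto simp: finite_nat_set_iff_bounded)
  have first: "x 0 = y 0" if "x \<in> X" "y \<in> X" "\<forall>i<m. x (Suc i) = y (Suc i)" for x y
  proof -
    have "shift x \<in> X" "shift y \<in> X" using that(1,2) shift_subset by auto
    moreover have "\<forall>i\<in>D. shift x i = shift y i" using that(3) m by (auto simp: shift_def)
    ultimately show ?thesis
      using D(2)[of "shift x" "shift y"] inv_into_f_f[OF inj] that(1,2) by simp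
  qed
  have det: "\<forall>i<n + m. x i = y i" if "x \<in> X" "y \<in> X" "\<forall>i<m. x (n + i) = y (n + i)" for x y n
    using that(3)
  proof (induction n)
    case (Suc n)
    have "x n = y n"
      using first[OF tail_in[OF that(1), of n] tail_in[OF that(2), of n]] Suc.prems by simp
    then have "x (n + i) = y (n + i)" if "i < m" for i
      using Suc.prems that by (cases i) auto
    then have "\<forall>i<n + m. x i = y i" by (intro Suc.IH) simp
    moreover have "x (n + m) = y (n + m)"
    proof (cases m)
      case 0
      with \<open>x n = y n\<close> show ?thesis by simp
    next
      case (Suc m')
      with Suc.prems show ?thesis by (metis add_Suc add_Suc_right lessI)
    qed
    ultimately show ?case by (auto simp: less_Suc_eq)
  qed simp
  \<comment> \<open>Only the position \<open>N\<close> at which the word is read depends on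
    \<open>G\<close>; the bound does not.\<close>
  have "card G \<le> card (UNIV :: 'a set) ^ m" if "G \<subseteq> X" "finite G" for G
  proof -
    obtain N where N: "\<And>x y. x \<in> G \<Longrightarrow> y \<in> G \<Longrightarrow> \<forall>i<N. x i = y i \<Longrightarrow> x = y"
      using finite_seqs_separated[OF \<open>finite G\<close>] by blast
    have "inj_on (\<lambda>x. map (\<lambda>i. x (N + i)) [0..<m]) G"
    proof (rule inj_onI)
      fix x y assume xy: "x \<in> G" "y \<in> G"
        and "map (\<lambda>i. x (N + i)) [0..<m] = map (\<lambda>i. y (N + i)) [0..<m]"
      then have "\<forall>i<m. x (N + i) = y (N + i)" by (simp add: map_eq_conv)
      with xy that(1) have "\<forall>i<N + m. x i = y i" by (intro det) auto
      then show "x = y" using xy by (intro N) auto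
    qed
    then have "card G \<le> card {w. set w \<subseteq> (UNIV :: 'a set) \<and> length w = m}"
      by (rule card_inj_on_le) (use finite_lists_length_eq[of "UNIV :: 'a set" m] in auto)
    then show ?thesis using card_lists_length_eq[of "UNIV :: 'a set" m] by simp
  qed
  then have "finite X" using finite_if_finite_subsets_card_bdd by blast
  then show False using infinite by blast
qed

section \<open>Word counts and finiteness of the set of branch points\<close>

lemma words_eq: "{w \<in> language X. length w = n} = (\<lambda>x. map x [0..<n]) ` X" (is "?L = ?R")
proof
  show "?L \<subseteq> ?R"
  proof clarify
    fix w assume "w \<in> language X" "n = length w"
    then obtain x i where "x \<in> X" "w = map (\<lambda>j. x (i + j)) [0..<n]"
      unfolding language_def by fastforce
    then show "w \<in> (\<lambda>x. map x [0..<length w]) ` X"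
      using tail_in[of x i] by (intro image_eqI[of _ _ "\<lambda>j. x (i + j)"]) auto
  qed
  show "?R \<subseteq> ?L"
  proof clarify
    fix x assume "x \<in> X"
    then have "map x [0..<n] \<in> language X"
      unfolding language_def by (intro CollectI exI[of _ x] exI[of _ 0] exI[of _ n]) auto
    then show "map x [0..<n] \<in> language X \<and> length (map x [0..<n]) = n" by simp
  qed
qed

text \<open>Surjectivity of the shift gives each word of length \<open>n\<close> a left extension. A
  branch point gives its prefix a second one, and from length \<open>N\<close> on different points
  of \<open>G\<close> have different prefixes.\<close>

lemma complexity_growth:
  assumes G: "G \<subseteq> branching X" "finite G"
    and N: "\<And>x y. x \<in> G \<Longrightarrow> y \<in> G \<Longrightarrow> \<forall>i<N. x i = y i \<Longrightarrow> x = y"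
    and n: "n \<ge> N"
  shows "complexity X n + card G \<le> complexity X (Suc n)"
proof -
  define P where "P n = (\<lambda>x. map x [0..<n]) ` X" for n
  have finP: "finite (P n)" for n
    by (rule finite_subset[OF _ finite_lists_length_eq[of UNIV n]]) (auto simp: P_def)
  have tl_word: "tl (map y [0..<Suc n]) = map (shift y) [0..<n]" for y :: "nat \<Rightarrow> 'a" and n
    by (simp add: map_upt_Suc shift_def del: upt_Suc)
  have "\<forall>w\<in>P n. \<exists>v. v \<in> P (Suc n) \<and> tl v = w"
  proof
    fix w assume "w \<in> P n"
    then obtain x where "x \<in> X" "w = map x [0..<n]" by (auto simp: P_def)
    moreover obtain y where "y \<in> X" "x = shift y" using shift_image \<open>x \<in> X\<close> by blast
    ultimately show "\<exists>v. v \<in> P (Suc n) \<and> tl v = w"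
      using tl_word unfolding P_def by blast
  qed
  from bchoice[OF this] obtain s where s: "\<And>w. w \<in> P n \<Longrightarrow> s w \<in> P (Suc n) \<and> tl (s w) = w"
    by blast
  \<comment> \<open>Two preimages of \<open>b\<close> extend its prefix by different letters, so at
    least one of these extensions is not the one chosen by \<open>s\<close>.\<close>
  have "\<forall>b\<in>G. \<exists>v. v \<in> P (Suc n) \<and> tl v = map b [0..<n] \<and> v \<noteq> s (map b [0..<n])"
  proof
    fix b assume "b \<in> G"
    then obtain y z where yz: "y \<in> X" "z \<in> X" "y \<noteq> z" "shift y = b" "shift z = b"
      using G(1) by (auto simp: branching_def)
    then have "y 0 \<noteq> z 0" using shift_eq_imp_eq by metis
    then have "map y [0..<Suc n] \<noteq> map z [0..<Suc n]"
      by (simp add: map_upt_Suc del: upt_Suc)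
    moreover have "map y [0..<Suc n] \<in> P (Suc n)" "map z [0..<Suc n] \<in> P (Suc n)"
      using yz by (auto simp: P_def simp del: upt_Suc)
    ultimately show "\<exists>v. v \<in> P (Suc n) \<and> tl v = map b [0..<n] \<and> v \<noteq> s (map b [0..<n])"
      using tl_word[of y n] tl_word[of z n] yz(4,5) by metis
  qed
  from bchoice[OF this] obtain t where t: "\<And>b. b \<in> G \<Longrightarrow>
      t b \<in> P (Suc n) \<and> tl (t b) = map b [0..<n] \<and> t b \<noteq> s (map b [0..<n])"
    by blast
  have "inj_on s (P n)"
    by (rule inj_onI) (metis s)
  moreover have "inj_on t G"
  proof (rule inj_onI)
    fix b c assume bc: "b \<in> G" "c \<in> G" "t b = t c"
    then have "map b [0..<n] = map c [0..<n]" using t by metis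
    then have "\<forall>i<N. b i = c i" using n by (auto simp: map_eq_conv)
    with bc N show "b = c" by blast
  qed
  moreover have "s ` P n \<inter> t ` G = {}"
  proof -
    have False if "w \<in> P n" "b \<in> G" "s w = t b" for w b
      using that s t by metis
    then show ?thesis by blast
  qed
  ultimately have "card (P n) + card G = card (s ` P n \<union> t ` G)"
    using finP G(2) by (simp add: card_Un_disjoint card_image)
  also have "\<dots> \<le> card (P (Suc n))"
    using s t finP by (intro card_mono) auto
  finally show ?thesis by (simp add: complexity_def words_eq P_def)
qed

text \<open>Each further letter of length adds at least \<open>card G\<close> words, so the slope
  \<open>a\<close> of the linear bound also bounds \<open>card G\<close>. As this holds for every
  finite set \<open>G\<close> of branch points, the whole set is finite.\<close>

lemma finite_branching:
  assumes "sublinear_complexity X"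
  shows "finite (branching X)"
proof -
  obtain a b :: real where ab: "\<And>n. real (complexity X n) \<le> a * real n + b"
    using assms by (auto simp: sublinear_complexity_def)
  have "card G \<le> nat \<lfloor>a\<rfloor>" if G: "G \<subseteq> branching X" "finite G" for G
  proof -
    obtain N where N: "\<And>x y. x \<in> G \<Longrightarrow> y \<in> G \<Longrightarrow> \<forall>i<N. x i = y i \<Longrightarrow> x = y"
      using finite_seqs_separated[OF G(2)] by blast
    have lower: "m * card G \<le> complexity X (N + m)" for m
    proof (induction m)
      case (Suc m)
      have "complexity X (N + m) + card G \<le> complexity X (Suc (N + m))"
        by (rule complexity_growth[OF G, of N]) (use N in blast, simp)
      with Suc show ?case by simp
    qed simp
    have "real (card G) \<le> a"
    proof (rule ccontr)
      assume "\<not> real (card G) \<le> a"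
      then have pos: "real (card G) - a > 0" by simp
      \<comment> \<open>Multiples of the positive gap between the two slopes outgrow the constant
        \<open>a * real N + b\<close>.\<close>
      then obtain m where "real m * (real (card G) - a) > a * real N + b"
        using reals_Archimedean3 by blast
      moreover have "real m * real (card G) \<le> a * real (N + m) + b"
        using lower[of m] ab[of "N + m"] by (metis of_nat_le_iff of_nat_mult order_trans)
      ultimately show False by (simp add: algebra_simps)
    qed
    then show ?thesis by (simp add: le_nat_floor)
  qed
  then show ?thesis using finite_if_finite_subsets_card_bdd by blast
qed

end

subsection \<open>Right asymptotic orbits\<close>

definition translate :: "int \<Rightarrow> (int \<Rightarrow> 'a) \<Rightarrow> int \<Rightarrow> 'a" where
  "translate m x = (\<lambda>i. x (i + m))"

text \<open>The bridge between the two shifts: one-sided results are applied to right halves of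
  two-sided points.\<close>

definition ray :: "(int \<Rightarrow> 'a) \<Rightarrow> int \<Rightarrow> nat \<Rightarrow> 'a" where
  "ray x i = (\<lambda>j. x (i + int j))"

text \<open>The relation behind \<open>right_asymptotic\<close>, on points in place of orbits and
  with an explicit threshold.\<close>

definition asymptotic :: "(int \<Rightarrow> 'a) \<Rightarrow> (int \<Rightarrow> 'a) \<Rightarrow> bool" where
  "asymptotic x y \<longleftrightarrow> (\<exists>m N. \<forall>n\<ge>N. x (m + n) = y n)"

lemma translate_0 [simp]: "translate 0 x = x"
  by (simp add: translate_def)

lemma translate_translate [simp]: "translate m (translate n x) = translate (m + n) x"
  by (simp add: translate_def add_ac)

lemma shift_eq_translate: "shift = translate 1"
  by (simp add: fun_eq_iff shift_def translate_def)

lemma ray_translate: "ray (translate m x) i = ray x (i + m)"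
  by (simp add: ray_def translate_def add_ac)

lemma continuous_map_translate: "continuous_map seq_topology seq_topology (translate m)"
  unfolding seq_topology_def translate_def continuous_map_componentwise_UNIV
  by (intro allI continuous_map_product_projection) simp

lemma mem_orbit_iff: "y \<in> orbit x \<longleftrightarrow> (\<exists>m. y = translate m x)"
  by (auto simp: orbit_def translate_def)

lemma orbit_translate [simp]: "orbit (translate m x) = orbit x"
proof -
  have "translate k x = translate (k - m) (translate m x)" for k by simp
  then show ?thesis
    unfolding set_eq_iff mem_orbit_iff by (metis translate_translate)
qed

lemma orbit_eq_iff: "orbit x = orbit y \<longleftrightarrow> (\<exists>m. y = translate m x)"
proof
  assume "orbit x = orbit y"
  then have "y \<in> orbit x" unfolding mem_orbit_iff using mem_orbit_iff translate_0 by metis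
  then show "\<exists>m. y = translate m x" by (simp add: mem_orbit_iff)
qed auto

lemma asymptotic_translate: "asymptotic x (translate m x)"
  unfolding asymptotic_def translate_def by (intro exI[of _ m]) (simp add: add_ac)

lemma asymptotic_sym: "asymptotic x y \<Longrightarrow> asymptotic y x"
proof -
  assume "asymptotic x y"
  then obtain m N where mN: "\<And>n. n \<ge> N \<Longrightarrow> x (m + n) = y n" by (auto simp: asymptotic_def)
  have "y (- m + n) = x n" if "n \<ge> N + m" for n
    using mN[of "n - m"] that by (simp add: algebra_simps)
  then show ?thesis unfolding asymptotic_def by blast
qed

lemma asymptotic_trans:
  assumes "asymptotic x y" "asymptotic y z"
  shows "asymptotic x z"
proof -
  obtain m N where mN: "\<And>n. n \<ge> N \<Longrightarrow> x (m + n) = y n"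
    using assms(1) by (auto simp: asymptotic_def)
  obtain m' N' where mN': "\<And>n. n \<ge> N' \<Longrightarrow> y (m' + n) = z n"
    using assms(2) by (auto simp: asymptotic_def)
  have "x ((m + m') + n) = z n" if "n \<ge> max N' (N - m')" for n
    using mN[of "m' + n"] mN'[of n] that by (simp add: algebra_simps)
  then show ?thesis unfolding asymptotic_def by blast
qed

text \<open>Agreement from \<open>N\<close> on bounds the positions of difference from above, so a
  largest one exists. Branch points are found there.\<close>

lemma last_difference:
  fixes x y :: "int \<Rightarrow> 'a"
  assumes "x \<noteq> y" and N: "\<And>n. n \<ge> N \<Longrightarrow> x n = y n"
  obtains d where "x d \<noteq> y d" "\<And>n. n > d \<Longrightarrow> x n = y n"
proof -
  obtain q where q: "x q \<noteq> y q" using assms(1) by auto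
  let ?S = "{i \<in> {q..N}. x i \<noteq> y i}"
  have qN: "q < N" using q N[of q] by linarith
  have fin: "finite ?S" by (rule finite_subset[of _ "{q..N}"]) auto
  have "q \<in> ?S" using q qN by simp
  then have M: "Max ?S \<in> ?S" using Max_in[OF fin] by blast
  show ?thesis
  proof (rule that[of "Max ?S"])
    show "x (Max ?S) \<noteq> y (Max ?S)" using M by simp
    fix n assume n: "n > Max ?S"
    show "x n = y n"
    proof (rule ccontr)
      assume ne: "x n \<noteq> y n"
      then have "n < N" using N[of n] by linarith
      moreover have "q \<le> n" using M n by simp
      ultimately have "n \<in> ?S" using ne by simp
      then show False using Max_ge[OF fin] n by fastforce
    qed
  qed
qed

text \<open>The equivalence class of \<open>orbit x\<close>, described through points so that the
  quotient need not be handled directly; \<open>right_asymptotic_Image\<close> identifies the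
  two.\<close>

definition asymptotic_class :: "(int \<Rightarrow> 'a) set \<Rightarrow> (int \<Rightarrow> 'a) \<Rightarrow> (int \<Rightarrow> 'a) set set" where
  "asymptotic_class X x = orbit ` {y \<in> X. asymptotic x y}"

text \<open>The relation speaks of some representatives of the two orbits; any other representative
  is a translate, and translates are asymptotic.\<close>

lemma right_asymptotic_Image:
  assumes "x \<in> X" "\<And>m y. y \<in> X \<Longrightarrow> translate m y \<in> X"
  shows "right_asymptotic X `` {orbit x} = asymptotic_class X x"
proof
  show "right_asymptotic X `` {orbit x} \<subseteq> asymptotic_class X x"
  proof
    fix P assume "P \<in> right_asymptotic X `` {orbit x}"
    then obtain x' y where *: "orbit x = orbit x'" "P = orbit y" "y \<in> X" "asymptotic x' y"
      by (auto simp: right_asymptotic_def eventually_at_top_linorder asymptotic_def)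
    then obtain m where "x' = translate m x" using orbit_eq_iff by blast
    then have "asymptotic x y" using *(4) asymptotic_translate asymptotic_trans by blast
    then show "P \<in> asymptotic_class X x" using * by (auto simp: asymptotic_class_def)
  qed
  show "asymptotic_class X x \<subseteq> right_asymptotic X `` {orbit x}"
  proof
    fix P assume "P \<in> asymptotic_class X x"
    then obtain y where y: "P = orbit y" "y \<in> X" "asymptotic x y"
      by (auto simp: asymptotic_class_def)
    then have "(orbit x, P) \<in> right_asymptotic X"
      using assms(1) unfolding right_asymptotic_def eventually_at_top_linorder asymptotic_def
      by blast
    then show "P \<in> right_asymptotic X `` {orbit x}" by blast
  qed
qed

lemma asymptotic_class_cong:
  assumes "asymptotic x y"
  shows "asymptotic_class X x = asymptotic_class X y"
proof -
  have "asymptotic x z \<longleftrightarrow> asymptotic y z" for z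
    using assms asymptotic_sym asymptotic_trans by blast
  then show ?thesis by (simp add: asymptotic_class_def)
qed

lemma orbit_in_asymptotic_class: "y \<in> X \<Longrightarrow> asymptotic x y \<Longrightarrow> orbit y \<in> asymptotic_class X x"
  by (simp add: asymptotic_class_def)

lemma asymptotic_refl: "asymptotic x x"
  using asymptotic_translate[of x 0] by simp

lemma orbit_in_asymptotic_classD:
  assumes "orbit y \<in> asymptotic_class X x"
  shows "asymptotic x y"
proof -
  obtain z where "orbit y = orbit z" "asymptotic x z"
    using assms by (auto simp: asymptotic_class_def)
  then show ?thesis
    using asymptotic_translate asymptotic_trans orbit_eq_iff by metis
qed

section \<open>Points, translates and block codes of the two-sided shift\<close>

context infinite_minimal_shift
begin

abbreviation "X2 \<equiv> two_sided X"

text \<open>The language only controls finite words; as \<open>X\<close> is closed, a ray all of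
  whose prefixes are words of the language lies in \<open>X\<close>.\<close>

lemma two_sided_iff: "x \<in> X2 \<longleftrightarrow> (\<forall>i. ray x i \<in> X)"
proof
  assume R: "\<forall>i. ray x i \<in> X"
  show "x \<in> X2"
    unfolding two_sided_def
  proof (intro CollectI allI)
    fix i n
    have "map (ray x i) [0..<n] \<in> {w \<in> language X. length w = n}"
      unfolding words_eq using R by blast
    then show "map (\<lambda>j. x (i + int j)) [0..<n] \<in> language X" by (simp add: ray_def)
  qed
next
  assume x: "x \<in> X2"
  show "\<forall>i. ray x i \<in> X"
  proof
    fix i
    show "ray x i \<in> X"
    proof (rule closedin_seq_topologyD[OF closed])
      fix D :: "nat set" assume "finite D"
      then obtain n where n: "\<And>j. j \<in> D \<Longrightarrow> j < n" by (auto simp: finite_nat_set_iff_bounded)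
      have "map (ray x i) [0..<n] \<in> {w \<in> language X. length w = n}"
        using x by (simp add: two_sided_def ray_def)
      then obtain z where "z \<in> X" "map (ray x i) [0..<n] = map z [0..<n]"
        unfolding words_eq by blast
      then show "\<exists>y\<in>X. \<forall>j\<in>D. y j = ray x i j"
        using n by (intro bexI[of _ z]) (auto simp: map_eq_conv)
    qed
  qed
qed

lemma ray_in: "x \<in> X2 \<Longrightarrow> ray x i \<in> X"
  by (simp add: two_sided_iff)

lemma translate_in: "x \<in> X2 \<Longrightarrow> translate m x \<in> X2"
  by (simp add: two_sided_iff ray_translate)

lemma translate_image: "translate m ` X2 = X2"
proof
  show "X2 \<subseteq> translate m ` X2"
  proof
    fix x assume "x \<in> X2"
    then show "x \<in> translate m ` X2"
      by (intro image_eqI[of _ _ "translate (- m) x"] translate_in) simp_all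
  qed
qed (auto intro: translate_in)

lemma closed_two_sided: "closedin seq_topology X2"
  unfolding closedin_seq_topology
proof (intro allI impI)
  fix x assume x: "\<forall>D. finite D \<longrightarrow> (\<exists>y\<in>X2. \<forall>i\<in>D. y i = x i)"
  have "ray x i \<in> X" for i
  proof (rule closedin_seq_topologyD[OF closed])
    fix D :: "nat set" assume "finite D"
    then obtain y where y: "y \<in> X2" "\<forall>k\<in>(\<lambda>j. i + int j) ` D. y k = x k"
      using x by (meson finite_imageI)
    then have "\<forall>j\<in>D. ray y i j = ray x i j" by (simp add: ray_def)
    then show "\<exists>y\<in>X. \<forall>j\<in>D. y j = ray x i j" using ray_in[OF y(1)] by blast
  qed
  then show "x \<in> X2" by (simp add: two_sided_iff)
qed

lemma shift_subset_two_sided: "shift ` X2 \<subseteq> X2"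
  by (simp add: shift_eq_translate translate_image)

lemma endomorphism_translate: "endomorphism X2 (translate m)"
  using continuous_map_from_subtopology[OF continuous_map_translate, of X2 m]
  by (auto simp: endomorphism_def continuous_map_in_subtopology translate_image
      shift_eq_translate add_ac intro: translate_in)

lemma endomorphism_commutes_translate:
  assumes f: "endomorphism X2 f" and x: "x \<in> X2"
  shows "f (translate m x) = translate m (f x)"
proof -
  have nonneg: "f (translate (int k) y) = translate (int k) (f y)" if "y \<in> X2" for k y
  proof (induction k)
    case (Suc k)
    have "f (translate (int (Suc k)) y) = f (shift (translate (int k) y))"
      by (simp add: shift_eq_translate add_ac)
    also have "\<dots> = shift (f (translate (int k) y))"
      using f translate_in[OF that] by (simp add: endomorphism_def)
    also have "\<dots> = translate (int (Suc k)) (f y)"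
      by (simp add: Suc shift_eq_translate add_ac)
    finally show ?case .
  qed simp
  show ?thesis
  proof (cases "m \<ge> 0")
    case True
    then show ?thesis using nonneg[OF x, of "nat m"] by simp
  next
    case False
    \<comment> \<open>For negative \<open>m\<close> the nonnegative case is applied at
      \<open>translate m x\<close>, and the translation by \<open>- m\<close> is then
      cancelled.\<close>
    have "f x = f (translate (int (nat (- m))) (translate m x))" using False by simp
    also have "\<dots> = translate (- m) (f (translate m x))"
      using nonneg[OF translate_in[OF x], of "nat (- m)" m] False by (simp del: translate_translate)
    finally have "f x = translate (- m) (f (translate m x))" .
    then show ?thesis by simp
  qed
qed

text \<open>The Curtis-Hedlund-Lyndon theorem. The positions \<open>a\<close> and \<open>b\<close>
  are independent because both windows can be translated to the origin.\<close>

lemma sliding_block: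
  assumes f: "endomorphism X2 f"
  obtains r :: int where "r \<ge> 0"
    "\<And>x y a b. x \<in> X2 \<Longrightarrow> y \<in> X2 \<Longrightarrow> (\<And>i. - r \<le> i \<Longrightarrow> i \<le> r \<Longrightarrow> x (a + i) = y (b + i)) \<Longrightarrow> f x a = f y b"
proof -
  obtain D where D: "finite D"
    "\<And>x y. x \<in> X2 \<Longrightarrow> y \<in> X2 \<Longrightarrow> \<forall>i\<in>D. x i = y i \<Longrightarrow> f x 0 = f y 0"
    using continuous_map_local_rule[OF closed_two_sided conjunct1[OF f[unfolded endomorphism_def]], of 0]
    by blast
  \<comment> \<open>Inserting 0 keeps \<open>Max\<close> meaningful for empty \<open>D\<close> and
    makes the radius nonnegative.\<close>
  define r where "r = Max (insert 0 (abs ` D))"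
  have r: "\<bar>i\<bar> \<le> r" if "i \<in> D" for i
    unfolding r_def using that D(1) by (intro Max_ge) auto
  show ?thesis
  proof (rule that[of r])
    show "r \<ge> 0" unfolding r_def using D(1) by (intro Max_ge) auto
    fix x y a b assume xy: "x \<in> X2" "y \<in> X2"
      and eq: "\<And>i. - r \<le> i \<Longrightarrow> i \<le> r \<Longrightarrow> x (a + i) = y (b + i)"
    have "translate a x i = translate b y i" if "i \<in> D" for i
      using eq[of i] r[OF that] by (simp add: translate_def add_ac abs_le_iff)
    then have "f (translate a x) 0 = f (translate b y) 0"
      using D(2) translate_in xy by blast
    then show "f x a = f y b"
      using endomorphism_commutes_translate[OF f] xy by (simp add: translate_def)
  qed
qed

text \<open>By minimality the word of \<open>y\<close> around \<open>i\<close> recurs in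
  \<open>x\<close> to the right of \<open>N\<close>. There \<open>f x\<close> and \<open>g x\<close>
  agree, and this word determines both \<open>f y i\<close> and \<open>g y i\<close>.\<close>

lemma endomorphisms_eq_of_tail:
  assumes f: "endomorphism X2 f" and g: "endomorphism X2 g"
    and x: "x \<in> X2" and tail: "\<And>n. n \<ge> N \<Longrightarrow> f x n = g x n" and y: "y \<in> X2"
  shows "f y = g y"
proof
  fix i
  obtain p where p: "p \<ge> 0" "\<And>x y a b. x \<in> X2 \<Longrightarrow> y \<in> X2 \<Longrightarrow>
      (\<And>i. - p \<le> i \<Longrightarrow> i \<le> p \<Longrightarrow> x (a + i) = y (b + i)) \<Longrightarrow> f x a = f y b"
    using sliding_block[OF f] by blast
  obtain q where q: "q \<ge> 0" "\<And>x y a b. x \<in> X2 \<Longrightarrow> y \<in> X2 \<Longrightarrow>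
      (\<And>i. - q \<le> i \<Longrightarrow> i \<le> q \<Longrightarrow> x (a + i) = y (b + i)) \<Longrightarrow> g x a = g y b"
    using sliding_block[OF g] by blast
  define r where "r = max p q"
  obtain j where j: "\<And>t. t < nat (2 * r + 1) \<Longrightarrow> ray x N (j + t) = ray y (i - r) t"
    using recurrence[OF ray_in[OF y] ray_in[OF x]] by blast
  \<comment> \<open>The centre of the recurring word in \<open>x\<close>: the window from
    \<open>a - r\<close> to \<open>a + r\<close> starts at \<open>N + int j\<close>.\<close>
  define a where "a = N + int j + r"
  have eq: "y (i + s) = x (a + s)" if "- r \<le> s" "s \<le> r" for s
    using j[of "nat (s + r)"] that by (simp add: ray_def a_def algebra_simps)
  have "f y i = f x a" by (rule p(2)[OF y x]) (use eq in \<open>simp add: r_def\<close>)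
  also have "\<dots> = g x a" using p(1) by (intro tail) (simp add: a_def r_def)
  also have "\<dots> = g y i"
    by (rule q(2)[OF x y]) (use eq in \<open>simp add: r_def\<close>)
  finally show "f y i = g y i" .
qed

section \<open>Last differences and finiteness of asymptotic classes\<close>

lemma aperiodic_two_sided:
  assumes x: "x \<in> X2" and p: "p \<noteq> 0" and per: "\<And>n. n \<ge> N \<Longrightarrow> x (n + p) = x n"
  shows False
proof -
  have *: False if "q > 0" "\<And>n. n \<ge> M \<Longrightarrow> x (n + q) = x n" for q M
  proof -
    have "nat q > 0" using that(1) by simp
    then obtain n where "ray x M (n + nat q) \<noteq> ray x M n"
      using aperiodic[OF ray_in[OF x, of M], of "nat q" 0] by blast
    then show False using that(2)[of "M + int n"] that(1) by (simp add: ray_def add_ac)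
  qed
  show False
  proof (cases "p > 0")
    case True
    then show ?thesis using *[of p N] per by blast
  next
    case False
    have "x (n + - p) = x n" if "n \<ge> N" for n
      using per[of "n - p"] that False by simp
    then show ?thesis using *[of "- p" N] False p by simp
  qed
qed

text \<open>From the last difference \<open>d\<close> on, the rays of \<open>x\<close> and
  \<open>y\<close> are two preimages of their common continuation.\<close>

lemma ray_branching:
  assumes "x \<in> X2" "y \<in> X2" "x d \<noteq> y d" "\<And>n. n > d \<Longrightarrow> x n = y n"
  shows "ray x (d + 1) \<in> branching X"
proof -
  have s: "shift (ray z d) = ray z (d + 1)" for z :: "int \<Rightarrow> 'a"
    by (simp add: shift_def ray_def add_ac)
  have "ray y (d + 1) = ray x (d + 1)"
    using assms(4) by (auto simp: ray_def)
  moreover have "ray x d \<noteq> ray y d"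
    using assms(3) by (auto simp: ray_def dest: fun_cong[of _ _ 0])
  ultimately show ?thesis
    unfolding branching_def
    by (intro CollectI conjI bexI[of _ "ray x d"] bexI[of _ "ray y d"])
      (simp_all add: s ray_in assms(1,2))
qed

text \<open>A point of the set is determined by its letters at the positions where some two points
  of the set differ for the last time. Those positions inject into the branch points, because a
  repetition would make \<open>x\<close> eventually periodic.\<close>

lemma finite_eventually_eq:
  assumes fin: "finite (branching X)" and x: "x \<in> X2"
  shows "finite {y \<in> X2. \<exists>N. \<forall>n\<ge>N. y n = x n}" (is "finite ?E")
proof -
  define S where "S = {d. \<exists>y\<in>?E. \<exists>z\<in>?E. y d \<noteq> z d \<and> (\<forall>n>d. y n = z n)}"
  have "\<forall>d\<in>S. \<exists>y\<in>?E. ray y (d + 1) \<in> branching X"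
    unfolding S_def using ray_branching by blast
  from bchoice[OF this[unfolded Bex_def]] obtain y where
    y: "\<And>d. d \<in> S \<Longrightarrow> y d \<in> ?E" "\<And>d. d \<in> S \<Longrightarrow> ray (y d) (d + 1) \<in> branching X"
    by blast
  have "inj_on (\<lambda>d. ray (y d) (d + 1)) S"
  proof (rule inj_onI, rule ccontr)
    fix c d assume cd: "c \<in> S" "d \<in> S" "ray (y c) (c + 1) = ray (y d) (d + 1)" "c \<noteq> d"
    obtain N where N: "\<And>n. n \<ge> N \<Longrightarrow> y c n = x n" using y(1)[OF cd(1)] by blast
    obtain M where M: "\<And>n. n \<ge> M \<Longrightarrow> y d n = x n" using y(1)[OF cd(2)] by blast
    \<comment> \<open>Past \<open>c + 1\<close> the equal rays can be compared; past the other two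
      thresholds \<open>y c\<close> at \<open>n\<close> and \<open>y d\<close> at
      \<open>n + (d - c)\<close> coincide with \<open>x\<close>.\<close>
    define K where "K = max (c + 1) (max N (M - (d - c)))"
    have per: "x (n + (d - c)) = x n" if "n \<ge> K" for n
    proof -
      have n: "n \<ge> c + 1" "n \<ge> N" "n \<ge> M - (d - c)" using that by (simp_all add: K_def)
      have "y c n = y d (n + (d - c))"
        using fun_cong[OF cd(3), of "nat (n - (c + 1))"] n by (simp add: ray_def algebra_simps)
      then show ?thesis using N[of n] M[of "n + (d - c)"] n by simp
    qed
    have "d - c \<noteq> 0" using cd(4) by simp
    from aperiodic_two_sided[OF x this, of K] per show False by blast
  qed
  moreover have "(\<lambda>d. ray (y d) (d + 1)) ` S \<subseteq> branching X" using y(2) by blast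
  ultimately have "finite S" using fin by (meson finite_imageD finite_subset)
  have "inj_on (\<lambda>y. restrict y S) ?E"
  proof (rule inj_onI, rule ccontr)
    fix y z assume yz: "y \<in> ?E" "z \<in> ?E" "restrict y S = restrict z S" "y \<noteq> z"
    from yz(1) obtain N where N: "\<And>n. n \<ge> N \<Longrightarrow> y n = x n" by blast
    from yz(2) obtain M where M: "\<And>n. n \<ge> M \<Longrightarrow> z n = x n" by blast
    have "y n = z n" if "n \<ge> max N M" for n using N M that by simp
    then obtain d where d: "y d \<noteq> z d" "\<And>n. n > d \<Longrightarrow> y n = z n"
      using last_difference[OF yz(4)] by blast
    then have "d \<in> S" using yz(1,2) unfolding S_def by blast
    then have "y d = z d" using fun_cong[OF yz(3), of d] by simp
    with d(1) show False ..
  qed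
  moreover have "(\<lambda>y. restrict y S) ` ?E \<subseteq> S \<rightarrow>\<^sub>E UNIV" by auto
  moreover have "finite (S \<rightarrow>\<^sub>E (UNIV :: 'a set))" using \<open>finite S\<close> by (intro finite_PiE) auto
  ultimately show "finite ?E" by (meson finite_imageD finite_subset)
qed

text \<open>Another representative of the orbit absorbs the offset, so that agreement holds index by
  index.\<close>

lemma asymptotic_alignment:
  assumes "asymptotic x y" "y \<in> X2"
  obtains z N where "z \<in> X2" "orbit z = orbit y" "\<And>n. n \<ge> N \<Longrightarrow> z n = x n"
proof -
  obtain m N where mN: "\<And>n. n \<ge> N \<Longrightarrow> x (m + n) = y n"
    using assms(1) by (auto simp: asymptotic_def)
  show ?thesis
  proof (rule that[of "translate (- m) y" "N + m"])
    fix n assume "n \<ge> N + m"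
    then show "translate (- m) y n = x n" using mN[of "n - m"] by (simp add: translate_def)
  qed (simp_all add: translate_in assms(2))
qed

text \<open>The class is covered by the orbits of points aligned with \<open>x\<close>. Finiteness
  makes \<open>card\<close> a true size, since it is 0 on infinite sets.\<close>

lemma finite_asymptotic_class:
  assumes "finite (branching X)" "x \<in> X2"
  shows "finite (asymptotic_class X2 x)"
proof (rule finite_subset)
  show "asymptotic_class X2 x \<subseteq> orbit ` {y \<in> X2. \<exists>N. \<forall>n\<ge>N. y n = x n}"
  proof
    fix P assume "P \<in> asymptotic_class X2 x"
    then obtain y where y: "P = orbit y" "y \<in> X2" "asymptotic x y"
      by (auto simp: asymptotic_class_def)
    obtain z N where "z \<in> X2" "orbit z = orbit y" "\<And>n. n \<ge> N \<Longrightarrow> z n = x n"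
      using asymptotic_alignment[OF y(3,2)] by blast
    with y(1) show "P \<in> orbit ` {y \<in> X2. \<exists>N. \<forall>n\<ge>N. y n = x n}" by blast
  qed
qed (use finite_eventually_eq[OF assms] in blast)

lemma asymptotic_classes_eq:
  "asymptotic_classes X2 k = {C \<in> asymptotic_class X2 ` X2. card C = k}"
proof -
  have "(orbit ` X2) // right_asymptotic X2 = asymptotic_class X2 ` X2"
    using right_asymptotic_Image[of _ X2] translate_in by (auto simp: quotient_def)
  then show ?thesis by (simp add: asymptotic_classes_def)
qed

text \<open>Representatives of two orbits of the class, aligned with \<open>x\<close>, are distinct
  points with a last difference; a translation moves the resulting branch point to position
  0.\<close>

lemma asymptotic_class_branching:
  assumes "x \<in> X2" "card (asymptotic_class X2 x) > 1"
  shows "\<exists>y\<in>X2. asymptotic x y \<and> ray y 0 \<in> branching X"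
proof -
  have "finite (asymptotic_class X2 x)"
    using assms(2) by (intro card_ge_0_finite) simp
  then obtain P Q where PQ: "P \<in> asymptotic_class X2 x" "Q \<in> asymptotic_class X2 x" "P \<noteq> Q"
    using assms(2) card_le_Suc0_iff_eq[of "asymptotic_class X2 x"] by force
  then obtain y' z' where yz': "P = orbit y'" "y' \<in> X2" "asymptotic x y'"
      "Q = orbit z'" "z' \<in> X2" "asymptotic x z'"
    by (auto simp: asymptotic_class_def)
  obtain y N where y: "y \<in> X2" "orbit y = P" "\<And>n. n \<ge> N \<Longrightarrow> y n = x n"
    using asymptotic_alignment[OF yz'(3,2)] yz'(1) by blast
  obtain z M where z: "z \<in> X2" "orbit z = Q" "\<And>n. n \<ge> M \<Longrightarrow> z n = x n"
    using asymptotic_alignment[OF yz'(6,5)] yz'(4) by blast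
  have ne: "y \<noteq> z" using PQ(3) y(2) z(2) by auto
  have "y n = z n" if "n \<ge> max N M" for n using y(3) z(3) that by simp
  then obtain d where d: "y d \<noteq> z d" "\<And>n. n > d \<Longrightarrow> y n = z n"
    using last_difference[OF ne] by blast
  have "ray (translate (d + 1) y) 0 \<in> branching X"
    using ray_branching[OF y(1) z(1) d] by (simp add: ray_translate)
  moreover have "asymptotic x (translate (d + 1) y)"
  proof -
    have "asymptotic x y" using y(3) unfolding asymptotic_def by (metis add_0)
    then show ?thesis using asymptotic_translate asymptotic_trans by blast
  qed
  ultimately show ?thesis using translate_in[OF y(1)] by blast
qed

text \<open>Each class has a point whose ray from 0 is a branch point. Points with equal rays are
  asymptotic, so assigning these branch points to the classes is injective.\<close>

lemma finite_asymptotic_classes: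
  assumes fin: "finite (branching X)" and k: "k > 1"
  shows "finite (asymptotic_classes X2 k)"
proof -
  have "\<forall>C\<in>asymptotic_classes X2 k. \<exists>y. y \<in> X2 \<and> C = asymptotic_class X2 y \<and> ray y 0 \<in> branching X"
  proof
    fix C assume "C \<in> asymptotic_classes X2 k"
    then obtain x where x: "x \<in> X2" "C = asymptotic_class X2 x" "card C > 1"
      using k by (auto simp: asymptotic_classes_eq)
    then show "\<exists>y. y \<in> X2 \<and> C = asymptotic_class X2 y \<and> ray y 0 \<in> branching X"
      using asymptotic_class_branching[of x] asymptotic_class_cong by blast
  qed
  from bchoice[OF this] obtain y where y: "\<And>C. C \<in> asymptotic_classes X2 k \<Longrightarrow>
      y C \<in> X2 \<and> C = asymptotic_class X2 (y C) \<and> ray (y C) 0 \<in> branching X"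
    by blast
  have "inj_on (\<lambda>C. ray (y C) 0) (asymptotic_classes X2 k)"
  proof (rule inj_onI)
    fix C D assume CD: "C \<in> asymptotic_classes X2 k" "D \<in> asymptotic_classes X2 k"
      "ray (y C) 0 = ray (y D) 0"
    have "y C (0 + n) = y D n" if "n \<ge> 0" for n
      using fun_cong[OF CD(3), of "nat n"] that by (simp add: ray_def)
    then have "asymptotic (y C) (y D)" unfolding asymptotic_def by blast
    then have "asymptotic_class X2 (y C) = asymptotic_class X2 (y D)"
      by (rule asymptotic_class_cong)
    then show "C = D" using y CD(1,2) by metis
  qed
  moreover have "(\<lambda>C. ray (y C) 0) ` asymptotic_classes X2 k \<subseteq> branching X" using y by blast
  ultimately show ?thesis using fin by (meson finite_imageD finite_subset)
qed

text \<open>A chosen preimage is taken again and again; each iterate prolongs the previous one by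
  one letter to the left.\<close>

lemma two_sided_extension:
  assumes u: "u \<in> X"
  shows "\<exists>x\<in>X2. ray x 0 = u"
proof -
  define g where "g = inv_into X shift"
  have g: "g v \<in> X" "shift (g v) = v" if "v \<in> X" for v
    unfolding g_def using that shift_image by (metis inv_into_into, metis f_inv_into_f)
  have gX: "(g ^^ k) u \<in> X" for k by (induction k) (auto intro: g u)
  have step: "(g ^^ (k + j)) u (j + i) = (g ^^ k) u i" for k j i
  proof (induction j)
    case (Suc j)
    have "(g ^^ (k + Suc j)) u (Suc j + i) = shift (g ((g ^^ (k + j)) u)) (j + i)"
      by (simp add: shift_def)
    then show ?case using g(2)[OF gX] Suc by simp
  qed simp
  \<comment> \<open>For \<open>i \<ge> 0\<close> this is \<open>u\<close> at \<open>i\<close>, since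
    \<open>nat (- i) = 0\<close>; for negative \<open>i\<close> it is the first letter of the
    iterate of order \<open>- i\<close>.\<close>
  define x where "x i = (g ^^ nat (- i)) u (nat i)" for i :: int
  have x: "ray x (- int k) = (g ^^ k) u" for k
  proof
    fix j
    show "ray x (- int k) j = (g ^^ k) u j"
    proof (cases "j \<le> k")
      case True
      then show ?thesis
        using step[of "k - j" j 0] by (simp add: ray_def x_def nat_diff_distrib of_nat_diff)
    next
      case False
      then show ?thesis
        using step[of 0 k "j - k"] by (simp add: ray_def x_def nat_diff_distrib)
    qed
  qed
  have "ray x i \<in> X" for i
  proof -
    \<comment> \<open>As \<open>i + int k\<close> is nonnegative, the ray from \<open>i\<close> is a
      tail of the ray from \<open>- int k\<close>.\<close>
    define k where "k = nat (- i)"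
    have "ray x i = (\<lambda>j. ray x (- int k) (nat (i + int k) + j))"
      by (simp add: ray_def k_def fun_eq_iff add_ac)
    then show ?thesis using tail_in[OF gX[of k]] x by simp
  qed
  then have "x \<in> X2" by (simp add: two_sided_iff)
  moreover have "ray x 0 = u" using x[of 0] by simp
  ultimately show ?thesis by blast
qed

text \<open>Two preimages of a branch point extend to two-sided points that agree from position 1
  on; were their orbits equal, one would be a translate of the other and hence eventually
  periodic.\<close>

lemma ex_asymptotic_class:
  assumes fin: "finite (branching X)"
  shows "\<exists>k>1. asymptotic_classes X2 k \<noteq> {}"
proof -
  obtain u v where uv: "u \<in> X" "v \<in> X" "u \<noteq> v" "shift u = shift v"
    using branching_nonempty by (force simp: branching_def)
  obtain x where x: "x \<in> X2" "ray x 0 = u" using two_sided_extension[OF uv(1)] by blast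
  obtain y where y: "y \<in> X2" "ray y 0 = v" using two_sided_extension[OF uv(2)] by blast
  have eq: "y n = x n" if "n \<ge> 1" for n
    using fun_cong[OF uv(4), of "nat (n - 1)"] that
    unfolding x(2)[symmetric] y(2)[symmetric] by (simp add: shift_def ray_def)
  have "orbit x \<noteq> orbit y"
  proof
    assume "orbit x = orbit y"
    then obtain p where p: "y = translate p x" by (auto simp: orbit_eq_iff)
    then have "p \<noteq> 0" using x(2) y(2) uv(3) by auto
    moreover have "x (n + p) = x n" if "n \<ge> 1" for n
      using eq[OF that] by (simp add: p translate_def)
    ultimately show False using aperiodic_two_sided[OF x(1)] by blast
  qed
  moreover have "orbit x \<in> asymptotic_class X2 x"
    using x(1) asymptotic_refl by (rule orbit_in_asymptotic_class)
  moreover have "asymptotic x y"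
    unfolding asymptotic_def using eq by (intro exI[of _ 0] exI[of _ 1]) simp
  with y(1) have "orbit y \<in> asymptotic_class X2 x"
    by (rule orbit_in_asymptotic_class)
  ultimately have "\<not> card (asymptotic_class X2 x) \<le> Suc 0"
    using card_le_Suc0_iff_eq[OF finite_asymptotic_class[OF fin x(1)]] by blast
  then show ?thesis
    using x(1) by (intro exI[of _ "card (asymptotic_class X2 x)"]) (auto simp: asymptotic_classes_eq)
qed

subsection \<open>Rigidity and the bounds\<close>

lemma endomorphism_commutes_tail:
  assumes f: "endomorphism X f" and x: "x \<in> X"
  shows "f (\<lambda>i. x (k + i)) = (\<lambda>i. f x (k + i))"
proof (induction k)
  case (Suc k)
  have "f (shift (\<lambda>i. x (k + i))) = shift (f (\<lambda>i. x (k + i)))"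
    using f tail_in[OF x] by (simp add: endomorphism_def)
  then show ?case by (simp add: Suc) (simp add: shift_def)
qed simp

text \<open>Every word of \<open>y\<close> recurs in \<open>b\<close> and both maps are block codes,
  so the equality at \<open>b\<close> spreads to \<open>y\<close>.\<close>

lemma endomorphisms_eq_of_point:
  assumes f: "endomorphism X f" and g: "endomorphism X g"
    and b: "b \<in> X" and eq: "f b = g b" and y: "y \<in> X"
  shows "f y = g y"
proof
  fix i
  obtain D where D: "finite D"
    "\<And>x y. x \<in> X \<Longrightarrow> y \<in> X \<Longrightarrow> \<forall>i\<in>D. x i = y i \<Longrightarrow> f x 0 = f y 0"
    using continuous_map_local_rule[OF closed conjunct1[OF f[unfolded endomorphism_def]], of 0]
    by blast
  obtain E where E: "finite E"
    "\<And>x y. x \<in> X \<Longrightarrow> y \<in> X \<Longrightarrow> \<forall>i\<in>E. x i = y i \<Longrightarrow> g x 0 = g y 0"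
    using continuous_map_local_rule[OF closed conjunct1[OF g[unfolded endomorphism_def]], of 0]
    by blast
  obtain r where r: "\<And>i. i \<in> D \<union> E \<Longrightarrow> i < r"
    using D(1) E(1) finite_nat_set_iff_bounded[of "D \<union> E"] by auto
  obtain j where j: "\<And>t. t < r \<Longrightarrow> b (j + t) = y (i + t)"
    using recurrence[OF tail_in[OF y] b] by blast
  have "f (\<lambda>t. b (j + t)) 0 = f (\<lambda>t. y (i + t)) 0"
    by (rule D(2)[OF tail_in[OF b] tail_in[OF y]]) (use j r in simp)
  moreover have "g (\<lambda>t. b (j + t)) 0 = g (\<lambda>t. y (i + t)) 0"
    by (rule E(2)[OF tail_in[OF b] tail_in[OF y]]) (use j r in simp)
  ultimately show "f y i = g y i"
    using eq by (simp add: endomorphism_commutes_tail[OF f] endomorphism_commutes_tail[OF g] b y)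
qed

text \<open>An automorphism maps the preimages of \<open>b\<close> onto those of \<open>f b\<close>,
  and injectivity keeps their number.\<close>

lemma automorphism_branch_points:
  assumes f: "endomorphism X f" "inj_on f X" and b: "b \<in> branch_points X k"
  shows "f b \<in> branch_points X k"
proof -
  have bX: "b \<in> X" using b by (simp add: branch_points_def)
  have fX: "f ` X = X" and com: "\<And>x. x \<in> X \<Longrightarrow> f (shift x) = shift (f x)"
    using f(1) by (auto simp: endomorphism_def)
  have "{y \<in> X. shift y = f b} = f ` {y \<in> X. shift y = b}"
  proof (intro equalityI subsetI)
    fix z assume z: "z \<in> {y \<in> X. shift y = f b}"
    then obtain y where y: "y \<in> X" "z = f y" using fX by blast
    then have "f (shift y) = f b" using z com by simp
    moreover have "shift y \<in> X" using y(1) shift_subset by blast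
    ultimately have "shift y = b" using f(2) bX by (meson inj_onD)
    with y show "z \<in> f ` {y \<in> X. shift y = b}" by blast
  qed (use fX com in force)
  moreover have "card (f ` {y \<in> X. shift y = b}) = card {y \<in> X. shift y = b}"
    by (rule card_image) (rule inj_on_subset[OF f(2)], auto)
  moreover have "f b \<in> X" using fX bX by blast
  ultimately show ?thesis using b by (simp add: branch_points_def)
qed

text \<open>Evaluation at a fixed branch point is injective on automorphisms and takes values among
  the branch points of the same order.\<close>

lemma card_Aut_le_branch_points:
  assumes fin: "finite (branch_points X k)" and ne: "branch_points X k \<noteq> {}"
  shows "finite (carrier (Aut_shift X)) \<and> card (carrier (Aut_shift X)) \<le> card (branch_points X k)"
proof -
  obtain b where b: "b \<in> branch_points X k" using ne by blast
  then have bX: "b \<in> X" by (simp add: branch_points_def)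
  \<comment> \<open>Written as an image under the identity to fit the counting lemma.\<close>
  have "finite ((\<lambda>f. f) ` carrier (Aut_shift X)) \<and>
      card ((\<lambda>f. f) ` carrier (Aut_shift X)) \<le> card (branch_points X k)"
  proof (rule card_image_le_of_factor[where F = "\<lambda>f. f b", OF fin])
    show "(\<lambda>f. f b) ` carrier (Aut_shift X) \<subseteq> branch_points X k"
      using automorphism_branch_points b by (auto simp: carrier_Aut_shift)
    fix f g assume "f \<in> carrier (Aut_shift X)" "g \<in> carrier (Aut_shift X)" "f b = g b"
    then show "f = g"
      using endomorphisms_eq_of_point[OF _ _ bX]
      by (intro extensionalityI[of _ X]) (auto simp: carrier_Aut_shift)
  qed
  then show ?thesis by simp
qed

section \<open>Action of two-sided automorphisms on asymptotic classes\<close>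

lemma endomorphism_asymptotic:
  assumes f: "endomorphism X2 f" and xy: "x \<in> X2" "y \<in> X2" "asymptotic x y"
  shows "asymptotic (f x) (f y)"
proof -
  obtain m N where mN: "\<And>n. n \<ge> N \<Longrightarrow> x (m + n) = y n"
    using xy(3) by (auto simp: asymptotic_def)
  obtain r where r: "r \<ge> 0" "\<And>x y a b. x \<in> X2 \<Longrightarrow> y \<in> X2 \<Longrightarrow>
      (\<And>i. - r \<le> i \<Longrightarrow> i \<le> r \<Longrightarrow> x (a + i) = y (b + i)) \<Longrightarrow> f x a = f y b"
    using sliding_block[OF f] by blast
  \<comment> \<open>Raising the threshold by the radius keeps the whole window where
    \<open>x\<close> and \<open>y\<close> agree.\<close>
  have "f x (m + n) = f y n" if "n \<ge> N + r" for n
  proof (rule r(2)[OF xy(1,2)])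
    fix i assume "- r \<le> i" "i \<le> r"
    then show "x (m + n + i) = y (n + i)" using mN[of "n + i"] that by (simp add: add_ac)
  qed
  then show ?thesis unfolding asymptotic_def by blast
qed

lemma endomorphism_orbit:
  assumes f: "endomorphism X2 f" and x: "x \<in> X2"
  shows "f ` orbit x = orbit (f x)"
proof -
  have o: "orbit z = range (\<lambda>m. translate m z)" for z :: "int \<Rightarrow> 'a"
    by (auto simp: mem_orbit_iff)
  show ?thesis
    by (simp add: o image_image endomorphism_commutes_translate[OF f x])
qed

text \<open>A class is a set of orbits, hence a set of sets of points, so the map acts on it through
  a nested image. The inverse endomorphism shows that every point asymptotic to \<open>f x\<close>
  is reached.\<close>

lemma automorphism_asymptotic_class:
  assumes f: "endomorphism X2 f" "inj_on f X2" and x: "x \<in> X2"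
  shows "(`) f ` asymptotic_class X2 x = asymptotic_class X2 (f x)"
proof -
  have fX: "f ` X2 = X2" using f(1) by (simp add: endomorphism_def)
  have inv: "endomorphism X2 (inv_into X2 f)"
    by (rule endomorphism_inverse[OF closed_two_sided shift_subset_two_sided f])
  have "f ` {y \<in> X2. asymptotic x y} = {z \<in> X2. asymptotic (f x) z}"
  proof (intro equalityI subsetI)
    fix z assume "z \<in> f ` {y \<in> X2. asymptotic x y}"
    then show "z \<in> {z \<in> X2. asymptotic (f x) z}"
      using endomorphism_asymptotic[OF f(1) x] fX by auto
  next
    fix z assume z: "z \<in> {z \<in> X2. asymptotic (f x) z}"
    then obtain y where y: "y \<in> X2" "z = f y" using fX by blast
    have "f x \<in> X2" "f y \<in> X2" using fX x y(1) by blast+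
    then have "asymptotic (inv_into X2 f (f x)) (inv_into X2 f (f y))"
      using endomorphism_asymptotic[OF inv] z y(2) by blast
    then have "asymptotic x y" using inv_into_f_f[OF f(2)] x y(1) by simp
    with y show "z \<in> f ` {y \<in> X2. asymptotic x y}" by blast
  qed
  moreover have "(`) f ` asymptotic_class X2 x = orbit ` f ` {y \<in> X2. asymptotic x y}"
    unfolding asymptotic_class_def image_image
    by (rule image_cong) (simp_all add: endomorphism_orbit[OF f(1)])
  ultimately show ?thesis by (simp add: asymptotic_class_def)
qed

text \<open>Taking images under an injective map is injective on subsets of \<open>X2\<close>, so
  the number of orbits is preserved.\<close>

lemma automorphism_asymptotic_classes:
  assumes f: "endomorphism X2 f" "inj_on f X2" and C: "C \<in> asymptotic_classes X2 k"
  shows "(`) f ` C \<in> asymptotic_classes X2 k"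
proof -
  obtain x where x: "x \<in> X2" "C = asymptotic_class X2 x" "card C = k"
    using C by (auto simp: asymptotic_classes_eq)
  have "orbit y \<subseteq> X2" if "y \<in> X2" for y
    using that translate_in by (auto simp: mem_orbit_iff)
  then have "C \<subseteq> Pow X2" by (auto simp: x(2) asymptotic_class_def)
  then have "card ((`) f ` C) = k"
    using x(3) card_image[OF inj_on_subset[OF inj_on_image_Pow[OF f(2)]]] by blast
  moreover have "f x \<in> X2" using f(1) x(1) by (auto simp: endomorphism_def)
  ultimately show ?thesis
    using automorphism_asymptotic_class[OF f x(1)] x(2) by (auto simp: asymptotic_classes_eq)
qed

text \<open>Equal images of the class make \<open>f x\<close> and \<open>g x\<close> asymptotic.
  After a translation they agree far to the right, and such agreement at one point forces equality
  everywhere.\<close>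

lemma automorphisms_differ_by_translate:
  assumes f: "endomorphism X2 f" "inj_on f X2" and g: "endomorphism X2 g" "inj_on g X2"
    and x: "x \<in> X2"
    and eq: "(`) f ` asymptotic_class X2 x = (`) g ` asymptotic_class X2 x"
  shows "\<exists>m. \<forall>y\<in>X2. g y = translate m (f y)"
proof -
  have "g x \<in> X2" using g(1) x by (auto simp: endomorphism_def)
  then have "orbit (g x) \<in> asymptotic_class X2 (f x)"
    using eq automorphism_asymptotic_class f g x asymptotic_refl orbit_in_asymptotic_class by metis
  then have "asymptotic (f x) (g x)" by (rule orbit_in_asymptotic_classD)
  then obtain m N where mN: "\<And>n. n \<ge> N \<Longrightarrow> f x (m + n) = g x n"
    by (auto simp: asymptotic_def)
  have "endomorphism X2 (translate m \<circ> f)"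
    using endomorphism_translate f(1) by (rule endomorphism_compose)
  moreover have "(translate m \<circ> f) x n = g x n" if "n \<ge> N" for n
    using mN[OF that] by (simp add: translate_def add_ac)
  ultimately have "(translate m \<circ> f) y = g y" if "y \<in> X2" for y
    using endomorphisms_eq_of_tail[OF _ g(1) x _ that] by blast
  then show ?thesis by (intro exI[of _ m]) simp
qed

section \<open>The subgroup of shift powers and its quotient\<close>

lemma group_Aut_two_sided: "group (Aut_shift X2)"
  using closed_two_sided shift_subset_two_sided by (rule group_Aut_shift)

lemma restrict_translate_in_Aut: "restrict (translate m) X2 \<in> carrier (Aut_shift X2)"
proof -
  have "inj_on (translate m) X2"
    by (rule inj_on_inverseI[of _ "translate (- m)"]) simp
  moreover have "endomorphism X2 (restrict (translate m) X2)"
    by (rule endomorphism_cong[OF endomorphism_translate shift_subset_two_sided]) simp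
  ultimately show ?thesis by (simp add: carrier_Aut_shift inj_on_restrict_eq)
qed

lemma mult_restrict_translate:
  "restrict (translate m) X2 \<otimes>\<^bsub>Aut_shift X2\<^esub> restrict (translate n) X2 = restrict (translate (m + n)) X2"
  unfolding mult_Aut_shift[OF restrict_translate_in_Aut restrict_translate_in_Aut]
  by (auto simp: compose_def translate_in)

lemma restrict_translate_0: "restrict (translate 0) X2 = \<one>\<^bsub>Aut_shift X2\<^esub>"
  by (auto simp: one_Aut_shift)

text \<open>Integer induction from 0: upwards by the generator, downwards by its inverse. This lets
  a coset absorb a translate.\<close>

lemma restrict_translate_in_shift_subgroup: "restrict (translate m) X2 \<in> shift_subgroup X2"
proof -
  interpret group "Aut_shift X2" by (rule group_Aut_two_sided)
  have s: "restrict (translate 1) X2 \<in> shift_subgroup X2"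
    unfolding shift_subgroup_def shift_eq_translate by (rule generate.incl) simp
  have "inv\<^bsub>Aut_shift X2\<^esub> (restrict (translate 1) X2) = restrict (translate (- 1)) X2"
    by (rule inv_equality)
      (simp_all add: mult_restrict_translate restrict_translate_in_Aut flip: restrict_translate_0)
  then have i: "restrict (translate (- 1)) X2 \<in> shift_subgroup X2"
    using generate.inv[of "restrict (translate 1) X2" "{restrict (translate 1) X2}" "Aut_shift X2"]
    unfolding shift_subgroup_def shift_eq_translate by simp
  have z: "restrict (translate 0) X2 \<in> shift_subgroup X2"
    unfolding restrict_translate_0 shift_subgroup_def by (rule generate.one)
  have step: "restrict (translate (m + n)) X2 \<in> shift_subgroup X2"
    if "restrict (translate m) X2 \<in> shift_subgroup X2" "restrict (translate n) X2 \<in> shift_subgroup X2"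
    for m n
    using generate.eng[OF that[unfolded shift_subgroup_def]]
    unfolding mult_restrict_translate shift_subgroup_def .
  show ?thesis
  proof (induction m rule: int_induct[where k = 0])
    case base
    show ?case by (rule z)
  next
    case (step1 n)
    then show ?case using s step by blast
  next
    case (step2 n)
    show ?case using step[OF step2(2) i] unfolding diff_conv_add_uminus .
  qed
qed

text \<open>Automorphisms permute the asymptotic classes of size \<open>k\<close>. Two of them with
  the same effect on a fixed class differ by a power of the shift, so the image of that class
  determines the coset.\<close>

lemma card_Aut_Mod_le_asymptotic_classes:
  assumes fin: "finite (asymptotic_classes X2 k)" and ne: "asymptotic_classes X2 k \<noteq> {}"
  shows "finite (carrier (Aut_shift X2 Mod shift_subgroup X2)) \<and>
    card (carrier (Aut_shift X2 Mod shift_subgroup X2)) \<le> card (asymptotic_classes X2 k)"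
proof -
  let ?G = "Aut_shift X2" and ?H = "shift_subgroup X2"
  interpret group ?G by (rule group_Aut_two_sided)
  obtain C where C: "C \<in> asymptotic_classes X2 k" using ne by blast
  then obtain x where x: "x \<in> X2" "C = asymptotic_class X2 x"
    by (auto simp: asymptotic_classes_eq)
  have H: "subgroup ?H ?G"
    unfolding shift_subgroup_def shift_eq_translate
    by (rule generate_is_subgroup) (simp add: restrict_translate_in_Aut)
  show ?thesis
    unfolding carrier_FactGroup
  proof (rule card_image_le_of_factor[where F = "\<lambda>f. (`) f ` C", OF fin])
    show "(\<lambda>f. (`) f ` C) ` carrier ?G \<subseteq> asymptotic_classes X2 k"
      using automorphism_asymptotic_classes[OF _ _ C] by (auto simp: carrier_Aut_shift)
    fix f g assume f: "f \<in> carrier ?G" and g: "g \<in> carrier ?G" and eq: "(`) f ` C = (`) g ` C"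
    obtain m where m: "\<And>y. y \<in> X2 \<Longrightarrow> g y = translate m (f y)"
      using automorphisms_differ_by_translate[of f g x] f g x eq by (auto simp: carrier_Aut_shift)
    let ?t = "restrict (translate m) X2"
    have t: "?t \<in> carrier ?G" "?t \<in> ?H"
      by (rule restrict_translate_in_Aut, rule restrict_translate_in_shift_subgroup)
    have "g = ?t \<otimes>\<^bsub>?G\<^esub> f"
    proof (rule extensionalityI)
      show "g \<in> extensional X2" using g by (simp add: carrier_Aut_shift)
      show "?t \<otimes>\<^bsub>?G\<^esub> f \<in> extensional X2"
        using m_closed[OF t(1) f] by (simp add: carrier_Aut_shift)
      fix y assume y: "y \<in> X2"
      have "f y \<in> X2" using f y by (auto simp: carrier_Aut_shift endomorphism_def)
      then show "g y = (?t \<otimes>\<^bsub>?G\<^esub> f) y"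
        using m[OF y] y by (simp add: mult_Aut_shift[OF t(1) f] compose_def)
    qed
    \<comment> \<open>These are right cosets, so the translate has to stand to the left of
      \<open>f\<close>, where \<open>?H\<close> absorbs it.\<close>
    then have "?H #>\<^bsub>?G\<^esub> g = ?H #>\<^bsub>?G\<^esub> ?t #>\<^bsub>?G\<^esub> f"
      using coset_mult_assoc[OF subgroup.subset[OF H] t(1) f] by simp
    then show "?H #>\<^bsub>?G\<^esub> f = ?H #>\<^bsub>?G\<^esub> g"
      using coset_join2[OF t(1) H t(2)] by simp
  qed
qed

end

theorem theorem2p3:
  fixes X1 :: "(nat \<Rightarrow> 'a::finite) set" and X2 :: "(int \<Rightarrow> 'a) set"
  assumes "minimal_one_sided_shift X1"
    and "infinite X1"
    and "X2 = two_sided X1"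
    and "sublinear_complexity X1"
  shows "(\<forall>k>1. finite (branch_points X1 k) \<and> finite (asymptotic_classes X2 k)) \<and>
    (finite (carrier (Aut_shift X1)) \<and> card (carrier (Aut_shift X1)) \<le> min_branch X1) \<and>
    (finite (carrier (Aut_shift X2 Mod shift_subgroup X2)) \<and>
     card (carrier (Aut_shift X2 Mod shift_subgroup X2)) \<le> min_asymptotic X2)"
proof -
  interpret infinite_minimal_shift X1
    using assms(1,2) by unfold_locales
  have fin: "finite (branching X1)" using assms(4) by (rule finite_branching)
  have finB: "finite (branch_points X1 k)" if "k > 1" for k
    using finite_subset[OF branch_points_subset_branching[OF that] fin] .
  have finC: "finite (asymptotic_classes X2 k)" if "k > 1" for k
    unfolding assms(3) using fin that by (rule finite_asymptotic_classes)
  let ?B = "{card (branch_points X1 k) | k. k > 1 \<and> card (branch_points X1 k) > 0}"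
  obtain k where "k > 1" "branch_points X1 k \<noteq> {}"
    using branching_nonempty branching_imp_branch_point[of _ X1] by blast
  \<comment> \<open>Finiteness turns nonemptiness into a positive \<open>card\<close>.\<close>
  then have "?B \<noteq> {}" using finB[of k] by (auto simp: card_gt_0_iff)
  \<comment> \<open>A nonempty set of naturals contains its \<open>Inf\<close>, so the minimum is
    attained at some order and it suffices to treat that order.\<close>
  then have "min_branch X1 \<in> ?B" unfolding min_branch_def by (rule Inf_nat_def1)
  then obtain k where k: "k > 1" "card (branch_points X1 k) > 0" "min_branch X1 = card (branch_points X1 k)"
    by blast
  let ?C = "{card (asymptotic_classes X2 k) | k. k > 1 \<and> card (asymptotic_classes X2 k) > 0}"
  obtain l where "l > 1" "asymptotic_classes X2 l \<noteq> {}"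
    using ex_asymptotic_class[OF fin] assms(3) by blast
  then have "?C \<noteq> {}" using finC[of l] by (auto simp: card_gt_0_iff)
  then have "min_asymptotic X2 \<in> ?C" unfolding min_asymptotic_def by (rule Inf_nat_def1)
  then obtain l where l: "l > 1" "card (asymptotic_classes X2 l) > 0"
      "min_asymptotic X2 = card (asymptotic_classes X2 l)"
    by blast
  have "finite (carrier (Aut_shift X1)) \<and> card (carrier (Aut_shift X1)) \<le> min_branch X1"
    unfolding k(3) using finB[OF k(1)] k(2) by (intro card_Aut_le_branch_points) auto
  moreover have "finite (carrier (Aut_shift X2 Mod shift_subgroup X2)) \<and>
      card (carrier (Aut_shift X2 Mod shift_subgroup X2)) \<le> min_asymptotic X2"
    unfolding l(3) using finC[OF l(1)] l(2) unfolding assms(3)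
    by (intro card_Aut_Mod_le_asymptotic_classes) auto
  ultimately show ?thesis using finB finC by blast
qed

end
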